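(* There is a uniform partial algorithm that, on input of: a finite presentation $P=\langle X\mid R\rangle$ of a group, a finite set of words $w_1,\dots,w_n\in X^{*}$ such that $\langle w_1,\dots,w_n\rangle^{\overline{P}}$ is finitely presentable, and a finite presentation $Q=\langle Y\mid S\rangle$ such that $\overline{Q}\cong\langle w_1,\dots,w_n\rangle^{\overline{P}}$; outputs: a finite set of words $c_1,\dots,c_k\in\{w_1,\dots,w_n\}^{*}$ such that each $c_i$ is trivial in $\overline{P}$ (when viewed as a word in $X^{*}$) and $\overline{\langle w_1,\dots,w_n\mid c_1,\dots,c_k\rangle}$ is isomorphic to $\overline{Q}$, and hence also to $\langle w_1,\dots,w_n\rangle^{\overline{P}}$.
   Context: Notation: for a group presentation $P=\langle X\mid R\rangle$, $\overline{P}$ denotes the group presented by $P$. $X^{*}$ denotes the set of finite words on $X\cup X^{-1}$, including the empty word. $\langle w_1,\dots,w_n\rangle^{\overline{P}}$ denotes the subgroup of $\overline{P}$ generated by the elements represented by $w_1,\dots,w_n$. In $\{w_1,\dots,w_n\}^{*}$ and in the presentation $\langle w_1,\dots,w_n\mid c_1,\dots,c_k\rangle$, the $w_i$ are treated as formal generators; a word in $\{w_1,\dots,w_n\}^{*}$ is viewed as a word in $X^{*}$ by substituting for each symbol $w_i$ the corresponding word in $X^{*}$. The isomorphism with $\langle w_1,\dots,w_n\rangle^{\overline{P}}$ is an abstract isomorphism of groups. The partial algorithm is required to halt with correct output on all inputs satisfying the stated conditions; nothing is required on other inputs. *)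

theory Defs
  imports "HOL-Algebra.Generated_Groups" "HOL-Library.Nat_Bijection"
begin

section \<open>Presented groups\<close>

text \<open>
  The letter \<open>(x, True)\<close> stands for the generator \<open>x\<close>, the letter \<open>(x, False)\<close> for its formal
  inverse; \<open>words X\<close> is the set of all (not necessarily reduced) words on \<open>X\<close> and its inverses.
\<close>

type_synonym 'a word = "('a \<times> bool) list"

definition words :: "'a set \<Rightarrow> 'a word set" where
  "words X = lists (X \<times> UNIV)"

definition word_inv :: "'a word \<Rightarrow> 'a word" where
  "word_inv w = rev (map (\<lambda>(x, b). (x, \<not> b)) w)"

text \<open>
  The smallest congruence on the monoid \<open>words X\<close> that identifies \<open>x x\<inverse>\<close> and \<open>x\<inverse> x\<close>, for \<open>x\<close> in
  \<open>X\<close>, and every relator with the empty word. Relators are meant to satisfy \<open>R \<subseteq> words X\<close>.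
\<close>

inductive word_eq :: "'a set \<Rightarrow> 'a word set \<Rightarrow> 'a word \<Rightarrow> 'a word \<Rightarrow> bool"
  for X :: "'a set" and R :: "'a word set" where
  refl: "w \<in> words X \<Longrightarrow> word_eq X R w w"
| sym: "word_eq X R v w \<Longrightarrow> word_eq X R w v"
| trans: "word_eq X R u v \<Longrightarrow> word_eq X R v w \<Longrightarrow> word_eq X R u w"
| cancel: "u \<in> words X \<Longrightarrow> v \<in> words X \<Longrightarrow> x \<in> X \<Longrightarrow>
    word_eq X R (u @ [(x, b), (x, \<not> b)] @ v) (u @ v)"
| relator: "u \<in> words X \<Longrightarrow> v \<in> words X \<Longrightarrow> r \<in> R \<Longrightarrow> word_eq X R (u @ r @ v) (u @ v)"

definition word_class :: "'a set \<Rightarrow> 'a word set \<Rightarrow> 'a word \<Rightarrow> 'a word set" where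
  "word_class X R w = {v. word_eq X R w v}"

definition presented_group :: "'a set \<Rightarrow> 'a word set \<Rightarrow> 'a word set monoid" where
  "presented_group X R =
    \<lparr>carrier = word_class X R ` words X,
     mult = (\<lambda>A B. \<Union>a\<in>A. \<Union>b\<in>B. word_class X R (a @ b)),
     one = word_class X R []\<rparr>"

definition finitely_presentable :: "('g, 'b) monoid_scheme \<Rightarrow> bool" where
  "finitely_presentable G \<longleftrightarrow>
    (\<exists>(X :: nat set) (R :: nat word set).
       finite X \<and> finite R \<and> R \<subseteq> words X \<and> G \<cong> presented_group X R)"

lemma words_append [simp]: "u @ v \<in> words X \<longleftrightarrow> u \<in> words X \<and> v \<in> words X"
  by (auto simp: words_def)

lemma words_Nil [simp]: "[] \<in> words X"
  by (simp add: words_def)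

lemma word_inv_in_words: "w \<in> words X \<Longrightarrow> word_inv w \<in> words X"
  by (auto simp: words_def word_inv_def lists_eq_set)

lemma word_eq_words:
  assumes "word_eq X R v w" "R \<subseteq> words X"
  shows "v \<in> words X \<and> w \<in> words X"
  using assms by (induction rule: word_eq.induct) (auto simp: words_def)

lemma word_eq_append:
  assumes "word_eq X R v w" "R \<subseteq> words X" "a \<in> words X" "b \<in> words X"
  shows "word_eq X R (a @ v @ b) (a @ w @ b)"
  using assms(1)
proof (induction rule: word_eq.induct)
  case (refl w)
  then show ?case using assms by (intro word_eq.refl) simp
next
  case (sym v w)
  show ?case by (rule word_eq.sym[OF sym.IH])
next
  case (trans u v w)
  show ?case by (rule word_eq.trans[OF trans.IH])
next
  case (cancel u v x c)
  then show ?case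
    using word_eq.cancel[of "a @ u" X "v @ b" x R c] assms by simp
next
  case (relator u v r)
  then show ?case
    using word_eq.relator[of "a @ u" X "v @ b" r R] assms by simp
qed

lemma word_class_eq_iff:
  assumes "v \<in> words X" "w \<in> words X"
  shows "word_class X R v = word_class X R w \<longleftrightarrow> word_eq X R v w"
proof
  assume eq: "word_class X R v = word_class X R w"
  have "w \<in> word_class X R w"
    using assms by (simp add: word_class_def word_eq.refl)
  then have "w \<in> word_class X R v" by (simp only: eq)
  then show "word_eq X R v w" by (simp add: word_class_def)
next
  assume vw: "word_eq X R v w"
  show "word_class X R v = word_class X R w"
    unfolding word_class_def
    using word_eq.trans[OF vw] word_eq.trans[OF word_eq.sym[OF vw]] by blast
qed

lemma word_eq_inv_left:
  assumes "w \<in> words X"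
  shows "word_eq X R (word_inv w @ w) []"
  using assms
proof (induction w)
  case Nil
  then show ?case by (auto simp: word_inv_def intro: word_eq.refl)
next
  case (Cons p w)
  obtain x b where p: "p = (x, b)" by fastforce
  have x: "x \<in> X" and w: "w \<in> words X" using Cons.prems p by (auto simp: words_def)
  have "word_eq X R (word_inv w @ [(x, \<not> b), (x, \<not> \<not> b)] @ w) (word_inv w @ w)"
    by (rule word_eq.cancel) (use x w in \<open>auto simp: word_inv_in_words\<close>)
  then show ?case using Cons.IH[OF w] p
    by (simp add: word_inv_def) (rule word_eq.trans)
qed

lemma mult_word_class:
  assumes R: "R \<subseteq> words X" and v: "v \<in> words X" and w: "w \<in> words X"
  shows "word_class X R v \<otimes>\<^bsub>presented_group X R\<^esub> word_class X R w = word_class X R (v @ w)"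
proof -
  have *: "word_class X R (a @ b) = word_class X R (v @ w)"
    if "a \<in> word_class X R v" "b \<in> word_class X R w" for a b
  proof -
    have va: "word_eq X R v a" and wb: "word_eq X R w b" using that by (auto simp: word_class_def)
    have a: "a \<in> words X" and b: "b \<in> words X"
      using word_eq_words[OF va R] word_eq_words[OF wb R] by auto
    have "word_eq X R (v @ w) (a @ w)" using word_eq_append[OF va R, of "[]" w] w by simp
    moreover have "word_eq X R (a @ w) (a @ b)"
      using word_eq_append[OF wb R, of a "[]"] a by simp
    ultimately have "word_eq X R (a @ b) (v @ w)" 
      by (rule word_eq.sym[OF word_eq.trans])
    then show ?thesis using a b v w by (subst word_class_eq_iff) auto
  qed
  have "v \<in> word_class X R v" "w \<in> word_class X R w"
    using v w by (auto simp: word_class_def intro: word_eq.refl)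
  then have "(\<Union>a\<in>word_class X R v. \<Union>b\<in>word_class X R w. word_class X R (a @ b)) =
      word_class X R (v @ w)"
    using * by blast
  then show ?thesis by (simp add: presented_group_def)
qed

lemma group_presented_group:
  assumes R: "R \<subseteq> words X"
  shows "group (presented_group X R)"
proof (rule groupI)
  let ?G = "presented_group X R"
  have car: "carrier ?G = word_class X R ` words X" and one: "\<one>\<^bsub>?G\<^esub> = word_class X R []"
    by (auto simp: presented_group_def)
  note mult = mult_word_class[OF R]
  show "x \<otimes>\<^bsub>?G\<^esub> y \<in> carrier ?G" if "x \<in> carrier ?G" "y \<in> carrier ?G" for x y
    using that by (auto simp: car mult)
  show "\<one>\<^bsub>?G\<^esub> \<in> carrier ?G" by (auto simp: car one)
  show "x \<otimes>\<^bsub>?G\<^esub> y \<otimes>\<^bsub>?G\<^esub> z = x \<otimes>\<^bsub>?G\<^esub> (y \<otimes>\<^bsub>?G\<^esub> z)"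
    if "x \<in> carrier ?G" "y \<in> carrier ?G" "z \<in> carrier ?G" for x y z
    using that by (auto simp: car mult)
  show "\<one>\<^bsub>?G\<^esub> \<otimes>\<^bsub>?G\<^esub> x = x" if "x \<in> carrier ?G" for x
    using that by (auto simp: car one mult)
  show "\<exists>y\<in>carrier ?G. y \<otimes>\<^bsub>?G\<^esub> x = \<one>\<^bsub>?G\<^esub>" if x: "x \<in> carrier ?G" for x
  proof -
    obtain w where w: "w \<in> words X" "x = word_class X R w" using x by (auto simp: car)
    have iw: "word_inv w \<in> words X" using w by (simp add: word_inv_in_words)
    have "word_class X R (word_inv w) \<otimes>\<^bsub>?G\<^esub> x = \<one>\<^bsub>?G\<^esub>"
      unfolding w(2) one mult[OF iw w(1)]
      using w iw word_eq_inv_left[OF w(1), of R] by (subst word_class_eq_iff) auto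
    then show ?thesis using iw by (auto simp: car)
  qed
qed


section \<open>Finite presentations and substitution of words\<close>

text \<open>
  As an input or output of an algorithm, a finite presentation is a pair \<open>(m, R)\<close>: the generating
  symbols are \<open>0, \<dots>, m - 1\<close>, and \<open>R\<close> lists the relators.
\<close>

type_synonym fin_pres = "nat \<times> nat word list"

definition gens :: "fin_pres \<Rightarrow> nat set" where
  "gens P = {..<fst P}"

definition relators :: "fin_pres \<Rightarrow> nat word set" where
  "relators P = set (snd P)"

definition is_fin_pres :: "fin_pres \<Rightarrow> bool" where
  "is_fin_pres P \<longleftrightarrow> relators P \<subseteq> words (gens P)"

definition group_of :: "fin_pres \<Rightarrow> nat word set monoid" where
  "group_of P = presented_group (gens P) (relators P)"

definition elem_of :: "fin_pres \<Rightarrow> nat word \<Rightarrow> nat word set" where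
  "elem_of P w = word_class (gens P) (relators P) w"

definition word_subgroup :: "fin_pres \<Rightarrow> nat word list \<Rightarrow> nat word set monoid" where
  "word_subgroup P ws = subgroup_generated (group_of P) (elem_of P ` set ws)"

text \<open>
  A word in the formal symbols \<open>w\<^sub>1, \<dots>, w\<^sub>n\<close> is a word on \<open>{..<n}\<close>, the symbol \<open>i\<close> standing
  for the word \<open>ws ! i\<close>. The next function reads such a word as a word on the original generators.
\<close>

definition subst_words :: "nat word list \<Rightarrow> nat word \<Rightarrow> nat word" where
  "subst_words ws c = concat (map (\<lambda>(i, b). if b then ws ! i else word_inv (ws ! i)) c)"


section \<open>Partial recursive functions\<close>

text \<open>
  Algorithms are Kleene's partial recursive functions; \<open>None\<close> means divergence (or a wrong number
  of arguments). Composition is strict, and \<open>Mu f\<close> yields the least \<open>n\<close> with \<open>f (n, xs) = 0\<close> such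
  that \<open>f (i, xs)\<close> is defined and nonzero for all \<open>i < n\<close>.
\<close>

datatype recf =
    Zero
  | Succ
  | Proj nat
  | Comp recf "recf list"
  | PrimRec recf recf
  | Mu recf

primrec rec_eval :: "recf \<Rightarrow> nat list \<Rightarrow> nat option" where
  "rec_eval Zero xs = Some 0"
| "rec_eval Succ xs = (case xs of [x] \<Rightarrow> Some (Suc x) | _ \<Rightarrow> None)"
| "rec_eval (Proj i) xs = (if i < length xs then Some (xs ! i) else None)"
| "rec_eval (Comp f gs) xs = Option.bind (those (map (\<lambda>h. h xs) (map rec_eval gs))) (rec_eval f)"
| "rec_eval (PrimRec f g) xs = (case xs of
      [] \<Rightarrow> None
    | n # ys \<Rightarrow>
        rec_nat (rec_eval f ys) (\<lambda>i r. Option.bind r (\<lambda>y. rec_eval g (i # y # ys))) n)"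
| "rec_eval (Mu f) xs =
    (let halts = (\<lambda>n. rec_eval f (n # xs) = Some 0 \<and>
                      (\<forall>i<n. \<exists>y. rec_eval f (i # xs) = Some (Suc y)))
     in if \<exists>n. halts n then Some (LEAST n. halts n) else None)"


section \<open>Coding of inputs and outputs\<close>

definition encode_letter :: "nat \<times> bool \<Rightarrow> nat" where
  "encode_letter = (\<lambda>(x, b). prod_encode (x, of_bool b))"

definition encode_word :: "nat word \<Rightarrow> nat" where
  "encode_word w = list_encode (map encode_letter w)"

definition encode_words :: "nat word list \<Rightarrow> nat" where
  "encode_words ws = list_encode (map encode_word ws)"

definition encode_pres :: "fin_pres \<Rightarrow> nat" where
  "encode_pres P = prod_encode (fst P, encode_words (snd P))"

end

theory Submission
  imports Defs
begin

text \<open>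
  The required output can be recognised by a finite certificate, so an unbounded search for one
  works. Besides the words \<open>c\<^sub>j\<close>, a certificate contains words \<open>f\<^sub>y\<close> in the \<open>w\<^sub>i\<close>, one for each
  generator \<open>y\<close> of \<open>Q\<close>, words \<open>g\<^sub>i\<close> in the generators of \<open>Q\<close>, and derivations showing that each
  \<open>c\<^sub>j\<close> is trivial in \<open>P\<close> and that \<open>y \<mapsto> f\<^sub>y\<close> and \<open>w\<^sub>i \<mapsto> g\<^sub>i\<close> define mutually inverse homomorphisms
  between the two presented groups. One exists: given an isomorphism of \<open>Q\<close> with the subgroup, let
  \<open>f\<^sub>y\<close> represent the image of \<open>y\<close>, let \<open>g\<^sub>i\<close> represent the preimage of \<open>w\<^sub>i\<close>, and take for the \<open>c\<^sub>j\<close>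
  the relators of \<open>Q\<close> rewritten by \<open>f\<close> together with the words \<open>f(g\<^sub>i) w\<^sub>i\<inverse>\<close>.
\<close>

section \<open>Recursive functions\<close>

definition r_add :: recf where "r_add = PrimRec (Proj 0) (Comp Succ [Proj 1])"
definition r_pred :: recf where "r_pred = PrimRec Zero (Proj 0)"
text \<open>The recursion runs on the first argument, which is therefore the number
  subtracted.\<close>

definition r_sub :: recf where "r_sub = PrimRec (Proj 0) (Comp r_pred [Proj 1])"
definition r_tri :: recf where "r_tri = PrimRec Zero (Comp r_add [Comp Succ [Proj 0], Proj 1])"
definition r_pair :: recf where
  "r_pair = Comp r_add [Comp r_tri [Comp r_add [Proj 0, Proj 1]], Proj 0]"

text \<open>
  Since \<open>prod_encode (x, y) = triangle (x + y) + x\<close>, the least \<open>k\<close> with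
  \<open>prod_encode (x, y) < triangle (Suc k)\<close> is \<open>x + y\<close>.
\<close>

definition r_diag :: recf where
  "r_diag = Mu (Comp r_sub [Comp r_tri [Comp Succ [Proj 0]], Comp Succ [Proj 1]])"
text \<open>If the input codes \<open>(x, y)\<close>, the first component is its excess over
  \<open>triangle (x + y)\<close>, and the second is \<open>x + y\<close> minus the first.\<close>

definition r_fst :: recf where "r_fst = Comp r_sub [Comp r_tri [r_diag], Proj 0]"
definition r_snd :: recf where "r_snd = Comp r_sub [r_fst, r_diag]"
text \<open>The recursion step receives the counter, the previous value and both branches in this
  order, so \<open>Proj 3\<close> is the second branch. Under the strict \<open>Comp\<close>, both
  branches must be defined.\<close>

definition r_ifz :: recf where "r_ifz = PrimRec (Proj 0) (Proj 3)"

primrec r_const :: "nat \<Rightarrow> recf" where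
  "r_const 0 = Zero"
| "r_const (Suc n) = Comp Succ [r_const n]"

lemma eval_const [simp]: "rec_eval (r_const n) xs = Some n"
  by (induction n) auto

lemma eval_add [simp]: "rec_eval r_add [x, y] = Some (x + y)"
  by (induction x) (auto simp: r_add_def)

lemma eval_pred [simp]: "rec_eval r_pred [x] = Some (x - 1)"
  by (induction x) (auto simp: r_pred_def)

lemma eval_sub [simp]: "rec_eval r_sub [x, y] = Some (y - x)"
  by (induction x) (auto simp: r_sub_def)

lemma eval_tri [simp]: "rec_eval r_tri [x] = Some (triangle x)"
  by (induction x) (auto simp: r_tri_def)

lemma eval_pair [simp]: "rec_eval r_pair [x, y] = Some (prod_encode (x, y))"
  by (simp add: r_pair_def prod_encode_def)

lemma eval_ifz [simp]: "rec_eval r_ifz [n, x, y] = Some (if n = 0 then x else y)"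
  by (induction n) (auto simp: r_ifz_def)

text \<open>When the test is total, the definedness condition in the semantics of \<open>Mu\<close>
  is automatic, and what remains of it characterises the least zero.\<close>

lemma eval_Mu:
  assumes "\<And>n. rec_eval f (n # xs) = Some (g n)" and "g m = 0"
  shows "rec_eval (Mu f) xs = Some (LEAST n. g n = 0)"
proof -
  have least: "g (LEAST n. g n = 0) = 0" using assms(2) by (rule LeastI)
  \<comment> \<open>Only the least zero meets the halting condition, so the outer
    \<open>LEAST\<close> ranges over a singleton.\<close>
  have *: "g n = 0 \<and> (\<forall>i<n. \<exists>y. g i = Suc y) \<longleftrightarrow> n = (LEAST n. g n = 0)" for n
    using least not_less_Least[of _ "\<lambda>n. g n = 0"]
    by (metis (mono_tags, lifting) linorder_neqE_nat not0_implies_Suc nat.simps(3))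
  have "rec_eval (Mu f) xs = (if \<exists>n. n = (LEAST n. g n = 0)
      then Some (LEAST n. n = (LEAST n. g n = 0)) else None)"
    unfolding rec_eval.simps Let_def assms(1) option.inject * by simp
  also have "(LEAST n. n = (LEAST n. g n = 0)) = (LEAST n. g n = 0)"
    by (rule Least_equality) auto
  finally show ?thesis by simp
qed

lemma triangle_mono: "m \<le> n \<Longrightarrow> triangle m \<le> triangle n"
  by (rule lift_Suc_mono_le[of triangle]) auto

lemma eval_diag [simp]: "rec_eval r_diag [prod_encode (x, y)] = Some (x + y)"
proof -
  let ?z = "prod_encode (x, y)"
  \<comment> \<open>Truncated subtraction turns \<open>?z < triangle (Suc k)\<close> into a zero
    test; the \<open>Suc\<close> in front of \<open>?z\<close> accounts for strictness.\<close>
  let ?g = "\<lambda>k. Suc ?z - triangle (Suc k)"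
  have zero: "?g (x + y) = 0" by (simp add: prod_encode_def)
  have "rec_eval r_diag [?z] = Some (LEAST k. ?g k = 0)"
    unfolding r_diag_def by (rule eval_Mu[where g = ?g]) (simp, rule zero)
  also have "(LEAST k. ?g k = 0) = x + y"
  proof (rule Least_equality)
    show "?g (x + y) = 0" by (rule zero)
  next
    fix k assume k: "?g k = 0"
    show "x + y \<le> k"
    proof (rule ccontr)
      assume "\<not> x + y \<le> k"
      then have "triangle (Suc k) \<le> triangle (x + y)" by (intro triangle_mono) simp
      with k show False by (simp add: prod_encode_def)
    qed
  qed
  finally show ?thesis .
qed

lemma eval_fst [simp]: "rec_eval r_fst [z] = Some (fst (prod_decode z))"
proof -
  obtain x y where "z = prod_encode (x, y)" by (metis prod_decode_inverse surj_pair)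
  then show ?thesis by (simp add: r_fst_def) (simp add: prod_encode_def)
qed

lemma eval_snd [simp]: "rec_eval r_snd [z] = Some (snd (prod_decode z))"
proof -
  obtain x y where "z = prod_encode (x, y)" by (metis prod_decode_inverse surj_pair)
  then show ?thesis by (simp add: r_snd_def)
qed

section \<open>Total recursive functions of one argument\<close>

text \<open>Unary functions suffice, because several arguments can be packed into one number by
  \<open>prod_encode\<close>.\<close>

definition recursive :: "(nat \<Rightarrow> nat) \<Rightarrow> bool" where
  "recursive f \<longleftrightarrow> (\<exists>r. \<forall>x. rec_eval r [x] = Some (f x))"

named_theorems recursive_intros

lemma recursive_id [recursive_intros]: "recursive (\<lambda>x. x)"
  unfolding recursive_def by (rule exI[of _ "Proj 0"]) simp

lemma recursive_const [recursive_intros]: "recursive (\<lambda>x. c)"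
  unfolding recursive_def by (rule exI[of _ "r_const c"]) simp

lemma recursive_unary:
  assumes "recursive f" and "\<And>x. rec_eval r [x] = Some (g x)"
  shows "recursive (\<lambda>x. g (f x))"
proof -
  obtain rf where "\<And>x. rec_eval rf [x] = Some (f x)" using assms by (auto simp: recursive_def)
  then show ?thesis using assms(2)
    unfolding recursive_def by (intro exI[of _ "Comp r [rf]"]) simp
qed

lemma recursive_comp: "recursive f \<Longrightarrow> recursive g \<Longrightarrow> recursive (\<lambda>x. g (f x))"
  unfolding recursive_def[of g] using recursive_unary by blast

lemma recursive_binary:
  assumes "recursive f" "recursive g" and "\<And>x y. rec_eval r [x, y] = Some (h x y)"
  shows "recursive (\<lambda>x. h (f x) (g x))"
proof -
  obtain rf where "\<And>x. rec_eval rf [x] = Some (f x)" using assms by (auto simp: recursive_def)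
  moreover obtain rg where "\<And>x. rec_eval rg [x] = Some (g x)"
    using assms by (auto simp: recursive_def)
  ultimately show ?thesis using assms(3)
    unfolding recursive_def by (intro exI[of _ "Comp r [rf, rg]"]) simp
qed

lemma recursive_Suc [recursive_intros]: "recursive f \<Longrightarrow> recursive (\<lambda>x. Suc (f x))"
  by (rule recursive_unary[of _ Succ]) auto

lemma recursive_fst [recursive_intros]: "recursive f \<Longrightarrow> recursive (\<lambda>x. fst (prod_decode (f x)))"
  by (rule recursive_unary[of f r_fst]) auto

lemma recursive_snd [recursive_intros]: "recursive f \<Longrightarrow> recursive (\<lambda>x. snd (prod_decode (f x)))"
  by (rule recursive_unary[of f r_snd]) auto

lemma recursive_pair [recursive_intros]:
  "recursive f \<Longrightarrow> recursive g \<Longrightarrow> recursive (\<lambda>x. prod_encode (f x, g x))"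
  by (rule recursive_binary[of f g r_pair]) auto

lemma recursive_add [recursive_intros]: "recursive f \<Longrightarrow> recursive g \<Longrightarrow> recursive (\<lambda>x. f x + g x)"
  by (rule recursive_binary[of f g r_add]) auto

lemma recursive_diff [recursive_intros]: "recursive f \<Longrightarrow> recursive g \<Longrightarrow> recursive (\<lambda>x. f x - g x)"
  by (rule recursive_binary[of g f r_sub]) auto

lemma recursive_if_zero [recursive_intros]:
  assumes "recursive p" "recursive f" "recursive g"
  shows "recursive (\<lambda>x. if p x = 0 then f x else g x)"
proof -
  obtain rp where "\<And>x. rec_eval rp [x] = Some (p x)" using assms by (auto simp: recursive_def)
  moreover obtain rf where "\<And>x. rec_eval rf [x] = Some (f x)"
    using assms by (auto simp: recursive_def)
  moreover obtain rg where "\<And>x. rec_eval rg [x] = Some (g x)"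
    using assms by (auto simp: recursive_def)
  ultimately show ?thesis
    unfolding recursive_def by (intro exI[of _ "Comp r_ifz [rp, rf, rg]"]) simp
qed

text \<open>Primitive recursion carries \<open>x\<close> along as a parameter and ignores the
  counter; \<open>F\<close> receives \<open>x\<close> together with the state, so that the iterated
  map may depend on the input.\<close>

lemma recursive_funpow:
  assumes "recursive F" "recursive n" "recursive s"
  shows "recursive (\<lambda>x. ((\<lambda>y. F (prod_encode (x, y))) ^^ n x) (s x))"
proof -
  obtain rF where F: "\<And>x. rec_eval rF [x] = Some (F x)" using assms by (auto simp: recursive_def)
  obtain rn where n: "\<And>x. rec_eval rn [x] = Some (n x)" using assms by (auto simp: recursive_def)
  obtain rs where s: "\<And>x. rec_eval rs [x] = Some (s x)" using assms by (auto simp: recursive_def)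
  \<comment> \<open>The recursion step sees counter, state and input in this order, hence
    \<open>Proj 2\<close> for the input and \<open>Proj 1\<close> for the state.\<close>
  have "rec_eval (PrimRec rs (Comp rF [Comp r_pair [Proj 2, Proj 1]])) [k, x]
      = Some (((\<lambda>y. F (prod_encode (x, y))) ^^ k) (s x))" for k x
    by (induction k) (auto simp: F s)
  then show ?thesis unfolding recursive_def using n
    by (intro exI[of _ "Comp (PrimRec rs (Comp rF [Comp r_pair [Proj 2, Proj 1]])) [rn, Proj 0]"])
       simp
qed

section \<open>Types coded by natural numbers\<close>

text \<open>Injectivity lets equality be tested on codes. On words, lists of words and presentations
  the instances reproduce the coding of inputs and outputs, as \<open>enc_word\<close>,
  \<open>enc_words\<close> and \<open>enc_pres\<close> confirm.\<close>

class encodable =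
  fixes enc :: "'a \<Rightarrow> nat"
  assumes inj_enc: "inj enc"

lemma enc_eq_iff [simp]: "enc x = enc y \<longleftrightarrow> x = y"
  by (rule inj_eq[OF inj_enc])

instantiation nat :: encodable
begin
definition enc_nat :: "nat \<Rightarrow> nat" where [simp]: "enc_nat n = n"
instance by standard (auto intro: injI)
end

instantiation bool :: encodable
begin
definition enc_bool :: "bool \<Rightarrow> nat" where [simp]: "enc_bool b = of_bool b"
instance by standard (auto intro: injI simp: of_bool_def split: if_splits)
end

instantiation prod :: (encodable, encodable) encodable
begin
definition enc_prod :: "'a \<times> 'b \<Rightarrow> nat" where
  [simp]: "enc_prod p = prod_encode (enc (fst p), enc (snd p))"
instance by standard (auto intro!: injI simp: prod_eq_iff)
end

instantiation list :: (encodable) encodable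
begin
definition enc_list :: "'a list \<Rightarrow> nat" where "enc_list xs = list_encode (map enc xs)"
instance proof
  show "inj (enc :: 'a list \<Rightarrow> nat)"
    by (rule injI) (use list_encode_eq inj_map_eq_map[OF inj_enc] in \<open>auto simp: enc_list_def\<close>)
qed
end

lemma enc_list_simps [simp]:
  "enc [] = 0" "enc (x # xs) = Suc (prod_encode (enc x, enc xs))"
  by (auto simp: enc_list_def)

section \<open>Computable maps between coded types\<close>

text \<open>The tracking function \<open>g\<close> is total, but its values at numbers that are not
  codes are left free.\<close>

definition computable :: "('a::encodable \<Rightarrow> 'b::encodable) \<Rightarrow> bool" where
  "computable f \<longleftrightarrow> (\<exists>g. recursive g \<and> (\<forall>x. g (enc x) = enc (f x)))"

lemma computableI: "recursive g \<Longrightarrow> (\<And>x. g (enc x) = enc (f x)) \<Longrightarrow> computable f"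
  by (auto simp: computable_def)

lemma computableE:
  assumes "computable f"
  obtains g where "recursive g" "\<And>x. g (enc x) = enc (f x)"
  using assms by (auto simp: computable_def)

named_theorems computable_intros

lemma computable_id [computable_intros]: "computable (\<lambda>x. x)"
  by (rule computableI[of "\<lambda>x. x"]) (auto intro: recursive_intros)

lemma computable_const [computable_intros]: "computable (\<lambda>x. c)"
  by (rule computableI[of "\<lambda>x. enc c"]) (auto intro: recursive_intros)

lemma computable_comp:
  assumes "computable f" "computable g"
  shows "computable (\<lambda>x. g (f x))"
proof -
  obtain f' where f: "recursive f'" "\<And>x. f' (enc x) = enc (f x)"
    using assms(1) by (rule computableE) auto
  obtain g' where g: "recursive g'" "\<And>x. g' (enc x) = enc (g x)"
    using assms(2) by (rule computableE) auto
  show ?thesis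
    by (rule computableI[OF recursive_comp[OF f(1) g(1)]]) (simp add: f g)
qed

lemma computable_Pair [computable_intros]:
  assumes "computable f" "computable g"
  shows "computable (\<lambda>x. (f x, g x))"
proof -
  obtain f' where f: "recursive f'" "\<And>x. f' (enc x) = enc (f x)"
    using assms(1) by (rule computableE) auto
  obtain g' where g: "recursive g'" "\<And>x. g' (enc x) = enc (g x)"
    using assms(2) by (rule computableE) auto
  show ?thesis
    by (rule computableI[OF recursive_pair[OF f(1) g(1)]]) (simp add: f g)
qed

lemma computable_fst [computable_intros]:
  fixes f :: "'a::encodable \<Rightarrow> 'b::encodable \<times> 'c::encodable"
  assumes "computable f" shows "computable (\<lambda>x. fst (f x))"
proof (rule computable_comp[OF assms])
  show "computable (fst :: 'b \<times> 'c \<Rightarrow> 'b)"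
    by (rule computableI[OF recursive_fst[OF recursive_id]]) simp
qed

lemma computable_snd [computable_intros]:
  fixes f :: "'a::encodable \<Rightarrow> 'b::encodable \<times> 'c::encodable"
  assumes "computable f" shows "computable (\<lambda>x. snd (f x))"
proof (rule computable_comp[OF assms])
  show "computable (snd :: 'b \<times> 'c \<Rightarrow> 'c)"
    by (rule computableI[OF recursive_snd[OF recursive_id]]) simp
qed

lemma computable_Suc [computable_intros]:
  assumes "computable f" shows "computable (\<lambda>x. Suc (f x))"
proof (rule computable_comp[OF assms])
  show "computable Suc" by (rule computableI[OF recursive_Suc[OF recursive_id]]) simp
qed

lemma computable_Cons [computable_intros]:
  assumes "computable f" "computable g"
  shows "computable (\<lambda>x. f x # g x)"
proof -
  obtain f' where f: "recursive f'" "\<And>x. f' (enc x) = enc (f x)"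
    using assms(1) by (rule computableE) auto
  obtain g' where g: "recursive g'" "\<And>x. g' (enc x) = enc (g x)"
    using assms(2) by (rule computableE) auto
  show ?thesis
    by (rule computableI[OF recursive_Suc[OF recursive_pair[OF f(1) g(1)]]]) (simp add: f g)
qed

lemma computable_if [computable_intros]:
  assumes "computable p" "computable f" "computable g"
  shows "computable (\<lambda>x. if p x then f x else g x)"
proof -
  obtain p' where p: "recursive p'" "\<And>x. p' (enc x) = enc (p x)"
    using assms(1) by (rule computableE) auto
  obtain f' where f: "recursive f'" "\<And>x. f' (enc x) = enc (f x)"
    using assms(2) by (rule computableE) auto
  obtain g' where g: "recursive g'" "\<And>x. g' (enc x) = enc (g x)"
    using assms(3) by (rule computableE) auto
  \<comment> \<open>The branches change places, since \<open>0\<close> codes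
    \<open>False\<close>.\<close>
  show ?thesis
    by (rule computableI[OF recursive_if_zero[OF p(1) g(1) f(1)]]) (simp add: p f g)
qed

lemma computable_not [computable_intros]:
  assumes "computable p" shows "computable (\<lambda>x. \<not> p x)"
proof -
  have "(\<lambda>x. \<not> p x) = (\<lambda>x. if p x then False else True)" by auto
  then show ?thesis using assms by (simp only:) (intro computable_intros)
qed

lemma computable_conj [computable_intros]:
  assumes "computable p" "computable q" shows "computable (\<lambda>x. p x \<and> q x)"
proof -
  have "(\<lambda>x. p x \<and> q x) = (\<lambda>x. if p x then q x else False)" by auto
  then show ?thesis using assms by (simp only:) (intro computable_intros)
qed

lemma computable_disj [computable_intros]:
  "computable p \<Longrightarrow> computable q \<Longrightarrow> computable (\<lambda>x. p x \<or> q x)"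
  using computable_not[OF computable_conj[OF computable_not computable_not]] by simp

text \<open>Codes are injective, so the test reduces to equality of numbers, which holds exactly
  when both truncated differences vanish.\<close>

lemma computable_eq [computable_intros]:
  assumes "computable f" "computable g"
  shows "computable (\<lambda>x. f x = g x)"
proof -
  obtain f' where f: "recursive f'" "\<And>x. f' (enc x) = enc (f x)"
    using assms(1) by (rule computableE) auto
  obtain g' where g: "recursive g'" "\<And>x. g' (enc x) = enc (g x)"
    using assms(2) by (rule computableE) auto
  show ?thesis
  proof (rule computableI)
    show "recursive (\<lambda>x. if (f' x - g' x) + (g' x - f' x) = 0 then 1 else 0)"
      by (intro recursive_intros f(1) g(1))
    have "a - b + (b - a) = 0 \<longleftrightarrow> a = b" for a b :: nat by auto
    then show "(if (f' (enc x) - g' (enc x)) + (g' (enc x) - f' (enc x)) = 0 then 1 else 0)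
        = enc (f x = g x)" for x
      by (simp add: f g del: add_is_0 diff_is_0_eq)
  qed
qed

lemma computable_less [computable_intros]:
  assumes "computable f" "computable g"
  shows "computable (\<lambda>x. f x < (g x :: nat))"
proof -
  obtain f' where f: "recursive f'" "\<And>x. f' (enc x) = enc (f x)"
    using assms(1) by (rule computableE) auto
  obtain g' where g: "recursive g'" "\<And>x. g' (enc x) = enc (g x)"
    using assms(2) by (rule computableE) auto
  show ?thesis
    by (rule computableI[of "\<lambda>x. if Suc (f' x) - g' x = 0 then 1 else 0"])
       (intro recursive_intros f(1) g(1), simp add: f g Suc_le_eq)
qed

section \<open>Iteration, folds and bounded quantifiers\<close>

text \<open>Computability of a family of functions is expressed by its uncurried form. The parameter
  \<open>x\<close> allows the iterated function to refer to the surrounding input; folds, maps and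
  bounded quantifiers below follow the same convention.\<close>

lemma computable_funpow:
  fixes F :: "'a::encodable \<Rightarrow> 'b::encodable \<Rightarrow> 'b"
  assumes "computable (\<lambda>p. F (fst p) (snd p))" "computable n" "computable s"
  shows "computable (\<lambda>x. (F x ^^ n x) (s x))"
proof -
  obtain F' where F: "recursive F'" "\<And>x. F' (enc x) = enc (F (fst x) (snd x))"
    using assms(1) by (rule computableE) auto
  obtain n' where n: "recursive n'" "\<And>x. n' (enc x) = enc (n x)"
    using assms(2) by (rule computableE) auto
  obtain s' where s: "recursive s'" "\<And>x. s' (enc x) = enc (s x)"
    using assms(3) by (rule computableE) auto
  have F2: "F' (prod_encode (enc x, enc y)) = enc (F x y)" for x y
    using F(2)[of "(x, y)"] by simp
  have "((\<lambda>y. F' (prod_encode (enc x, y))) ^^ k) (enc y) = enc ((F x ^^ k) y)" for x y k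
    by (induction k) (auto simp: F2)
  then show ?thesis
    by (intro computableI[OF recursive_funpow[OF F(1) n(1) s(1)]]) (simp add: n s)
qed

lemma length_le_enc: "length xs \<le> enc xs"
  by (induction xs) (auto intro: order.trans[OF _ le_prod_encode_2])

text \<open>The loop consumes the code of the list; the code itself bounds the number of rounds.\<close>

lemma computable_foldl:
  assumes "computable (\<lambda>p. F (fst p) (fst (snd p)) (snd (snd p)))" "computable a" "computable l"
  shows "computable (\<lambda>x. foldl (F x) (a x) (l x))"
proof -
  obtain F' where F: "recursive F'"
      "\<And>x. F' (enc x) = enc (F (fst x) (fst (snd x)) (snd (snd x)))"
    using assms(1) by (rule computableE) auto
  obtain a' where a: "recursive a'" "\<And>x. a' (enc x) = enc (a x)"
    using assms(2) by (rule computableE) auto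
  obtain l' where l: "recursive l'" "\<And>x. l' (enc x) = enc (l x)"
    using assms(3) by (rule computableE) auto
  have F2: "F' (prod_encode (enc x, prod_encode (enc b, enc y))) = enc (F x b y)" for x b y
    using F(2)[of "(x, b, y)"] by simp
  define \<pi>\<^sub>1 \<pi>\<^sub>2 where \<pi>: "\<pi>\<^sub>1 z = fst (prod_decode z)" "\<pi>\<^sub>2 z = snd (prod_decode z)" for z
  \<comment> \<open>The argument codes \<open>(x, (b, ys))\<close> with accumulator
    \<open>b\<close>. As \<open>0\<close> codes the empty list and a nonempty list has
    \<open>Suc\<close> of a pair as its code, \<open>t\<close> codes the pair of head and tail. An
    exhausted list leaves the state \<open>s\<close> unchanged.\<close>
  define step where "step p = (let s = \<pi>\<^sub>2 p; t = \<pi>\<^sub>2 s - 1 in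
    if \<pi>\<^sub>2 s = 0 then s
    else prod_encode (F' (prod_encode (\<pi>\<^sub>1 p, prod_encode (\<pi>\<^sub>1 s, \<pi>\<^sub>1 t))), \<pi>\<^sub>2 t))" for p
  have "recursive step"
    unfolding step_def Let_def \<pi> by (intro recursive_intros recursive_comp[OF _ F(1)])
  note rec = recursive_fst[OF recursive_funpow[OF this l(1) recursive_pair[OF a(1) l(1)]]]
  have step0: "step (prod_encode (x, prod_encode (b, 0))) = prod_encode (b, 0)" for x b
    by (simp add: step_def \<pi>)
  have step1: "step (prod_encode (enc x, prod_encode (enc b, enc (y # ys))))
      = prod_encode (enc (F x b y), enc ys)" for x b y ys
    by (simp add: step_def \<pi> F2)
  \<comment> \<open>The code of the list can exceed its length, so the loop has to idle after the
    last entry.\<close>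
  have stop: "((\<lambda>y. step (prod_encode (x, y))) ^^ k) (prod_encode (b, 0)) = prod_encode (b, 0)"
    for x b k
    by (induction k) (auto simp: step0)
  have "((\<lambda>y. step (prod_encode (enc x, y))) ^^ k) (prod_encode (enc b, enc ys))
      = prod_encode (enc (foldl (F x) b ys), 0)" if "length ys \<le> k" for x b k ys
    using that
  proof (induction ys arbitrary: b k)
    case Nil
    then show ?case by (simp add: stop)
  next
    case (Cons y ys)
    then obtain k' where "k = Suc k'" "length ys \<le> k'" by (cases k) auto
    then show ?case using Cons.IH by (simp add: funpow_Suc_right step1 del: funpow.simps enc_list_simps)
  qed
  then show ?thesis
    by (intro computableI[OF rec]) (simp add: a l length_le_enc)
qed

lemma computable_rev [computable_intros]:
  assumes "computable l" shows "computable (\<lambda>x. rev (l x))"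
proof -
  have "foldl (\<lambda>a y. y # a) a xs = rev xs @ a" for a xs :: "'b list"
    by (induction xs arbitrary: a) auto
  then have "rev xs = foldl (\<lambda>a y. y # a) [] xs" for xs :: "'b list" by simp
  then show ?thesis
    by (simp only:) (intro computable_foldl computable_intros assms)
qed

lemma computable_append [computable_intros]:
  assumes "computable l" "computable m" shows "computable (\<lambda>x. l x @ m x)"
proof -
  have "foldl (\<lambda>a y. y # a) a xs = rev xs @ a" for a xs :: "'b list"
    by (induction xs arbitrary: a) auto
  then have "xs @ ys = foldl (\<lambda>a y. y # a) ys (rev xs)" for xs ys :: "'b list" by simp
  then show ?thesis
    by (simp only:) (intro computable_foldl computable_intros assms)
qed

lemma computable_length [computable_intros]:
  assumes "computable l" shows "computable (\<lambda>x. length (l x))"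
proof -
  have "foldl (\<lambda>a y. Suc a) a xs = length xs + a" for a and xs :: "'b list"
    by (induction xs arbitrary: a) auto
  then have "length xs = foldl (\<lambda>a y. Suc a) 0 xs" for xs :: "'b list" by simp
  then show ?thesis
    by (simp only:) (intro computable_foldl computable_intros assms)
qed

lemma computable_map [computable_intros]:
  assumes "computable (\<lambda>p. f (fst p) (snd p))" "computable l"
  shows "computable (\<lambda>x. map (\<lambda>y. f x y) (l x))"
proof -
  have "foldl (\<lambda>a y. a @ [f x y]) a xs = a @ map (f x) xs" for a xs x
    by (induction xs arbitrary: a) auto
  then have *: "map (\<lambda>y. f x y) xs = foldl (\<lambda>a y. a @ [f x y]) [] xs" for xs x by simp
  \<comment> \<open>The fold supplies parameter, accumulator and entry, of which \<open>f\<close>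
    reads the first and the last.\<close>
  have "computable (\<lambda>p. f (fst p) (snd (snd p)))"
    using computable_comp[OF _ assms(1), of "\<lambda>p. (fst p, snd (snd p))"]
    by (simp add: computable_intros)
  then show ?thesis unfolding *
    by (intro computable_foldl computable_intros assms)
qed

lemma computable_concat [computable_intros]:
  assumes "computable l" shows "computable (\<lambda>x. concat (l x))"
proof -
  have "foldl (\<lambda>a y. a @ y) a xs = a @ concat xs" for a and xs :: "'b list list"
    by (induction xs arbitrary: a) auto
  then have "concat xs = foldl (\<lambda>a y. a @ y) [] xs" for xs :: "'b list list" by simp
  then show ?thesis
    by (simp only:) (intro computable_foldl computable_intros assms)
qed

text \<open>A fold accumulates the conjunction. Quantifying over the entries of a list keeps the
  check of a certificate total.\<close>

lemma computable_ball_set [computable_intros]: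
  assumes "computable (\<lambda>p. f (fst p) (snd p))" "computable l"
  shows "computable (\<lambda>x. \<forall>y\<in>set (l x). f x y)"
proof -
  have "foldl (\<lambda>a y. a \<and> f x y) a xs \<longleftrightarrow> a \<and> (\<forall>y\<in>set xs. f x y)" for a xs x
    by (induction xs arbitrary: a) auto
  then have *: "(\<forall>y\<in>set xs. f x y) \<longleftrightarrow> foldl (\<lambda>a y. a \<and> f x y) True xs" for xs x by simp
  have "computable (\<lambda>p. f (fst p) (snd (snd p)))"
    using computable_comp[OF _ assms(1), of "\<lambda>p. (fst p, snd (snd p))"]
    by (simp add: computable_intros)
  then show ?thesis unfolding *
    by (intro computable_foldl computable_intros assms)
qed

lemma computable_bex_set [computable_intros]:
  assumes "computable (\<lambda>p. f (fst p) (snd p))" "computable l"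
  shows "computable (\<lambda>x. \<exists>y\<in>set (l x). f x y)"
  using computable_not[OF computable_ball_set[OF computable_not[OF assms(1)] assms(2)]] by simp

lemma computable_mem [computable_intros]:
  assumes "computable f" "computable l" shows "computable (\<lambda>x. f x \<in> set (l x))"
proof -
  have *: "f x \<in> set xs \<longleftrightarrow> (\<exists>y\<in>set xs. y = f x)" for x xs by auto
  show ?thesis unfolding *
    by (intro computable_intros computable_comp[OF _ assms(1)] assms(2))
qed

text \<open>The length of the list built so far is its next entry, so repeated appending works
  without a separate counter.\<close>

lemma computable_upt [computable_intros]:
  assumes "computable n" shows "computable (\<lambda>x. [0..<n x])"
proof -
  have "((\<lambda>l. l @ [length l]) ^^ k) [] = [0..<k]" for k
    by (induction k) auto
  then have "[0..<k] = ((\<lambda>l. l @ [length l]) ^^ k) []" for k by simp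
  then show ?thesis
    by (simp only:) (intro computable_funpow computable_intros assms)
qed

text \<open>The default replaces the unspecified values of \<open>xs ! i\<close>, which need not be computable.\<close>

definition nth_default :: "'a \<Rightarrow> 'a list \<Rightarrow> nat \<Rightarrow> 'a" where
  "nth_default d xs i = (if i < length xs then xs ! i else d)"

lemma computable_nth_default [computable_intros]:
  assumes "computable l" "computable n"
  shows "computable (\<lambda>x. nth_default d (l x) (n x))"
proof -
  \<comment> \<open>The accumulator consists of a running index and the entry found so far,
    initially the default.\<close>
  have fst: "fst (foldl (\<lambda>a y. (Suc (fst a), if fst a = i then y else snd a)) (k, d) xs)
      = k + length xs" for i k d and xs :: "'b list"
    by (induction xs arbitrary: k d) auto
  have snd: "snd (foldl (\<lambda>a y. (Suc (fst a), if fst a = i then y else snd a)) (0, d) xs)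
      = nth_default d xs i" for i d and xs :: "'b list"
    by (induction xs rule: rev_induct) (auto simp: fst nth_append nth_default_def)
  show ?thesis unfolding snd[symmetric]
    by (intro computable_foldl computable_intros computable_comp[OF _ assms(2)] assms(1))
qed

section \<open>Surjective decodings and unbounded search\<close>

text \<open>
  Not every number is a code (for booleans, only 0 and 1 are), so unbounded search runs over the
  values of a surjective computable decoding.
\<close>

class enumerable = encodable +
  assumes ex_enumeration: "\<exists>d :: nat \<Rightarrow> 'a. recursive (\<lambda>n. enc (d n)) \<and> surj d"

lemma computable_nat_iff: "computable d \<longleftrightarrow> recursive (\<lambda>n. enc (d n))" for d :: "nat \<Rightarrow> 'a::encodable"
proof
  assume "computable d"
  then obtain g where "recursive g" "\<And>n. g n = enc (d n)" by (auto simp: computable_def)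
  then show "recursive (\<lambda>n. enc (d n))" by (metis (no_types) ext)
qed (auto intro: computableI)

lemma ex_decoder: "\<exists>d :: nat \<Rightarrow> 'a::enumerable. computable d \<and> surj d"
  using ex_enumeration by (simp add: computable_nat_iff)

instance nat :: enumerable
  by standard (auto intro!: exI[of _ "\<lambda>n. n"] recursive_intros)

instance bool :: enumerable
proof
  have "surj (\<lambda>n :: nat. n = 0)"
  proof (rule surjI)
    show "((if b then 0 else 1) = (0 :: nat)) = b" for b by simp
  qed
  moreover have "computable (\<lambda>n :: nat. n = 0)" by (intro computable_intros)
  ultimately show "\<exists>d :: nat \<Rightarrow> bool. recursive (\<lambda>n. enc (d n)) \<and> surj d"
    unfolding computable_nat_iff by blast
qed

instance prod :: (enumerable, enumerable) enumerable
proof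
  obtain d :: "nat \<Rightarrow> 'a" where d: "computable d" "surj d" using ex_decoder by auto
  obtain d' where d': "\<And>x. d (d' x) = x" using surj_f_inv_f[OF d(2)] by blast
  obtain e :: "nat \<Rightarrow> 'b" where e: "computable e" "surj e" using ex_decoder by auto
  obtain e' where e': "\<And>x. e (e' x) = x" using surj_f_inv_f[OF e(2)] by blast
  let ?f = "\<lambda>n. (d (fst (prod_decode n)), e (snd (prod_decode n)))"
  \<comment> \<open>\<open>prod_decode n\<close> is a pair with code \<open>n\<close>, so the
    identity tracks the decoding; the same holds for \<open>list_decode\<close> in the next
    instance.\<close>
  have "computable prod_decode"
    by (rule computableI[OF recursive_id]) simp
  then have "computable ?f"
    by (intro computable_Pair computable_comp[OF _ d(1)] computable_comp[OF _ e(1)]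
      computable_fst computable_snd)
  moreover have "surj ?f"
  proof (rule surjI)
    fix p
    show "(d (fst (prod_decode (prod_encode (d' (fst p), e' (snd p))))),
      e (snd (prod_decode (prod_encode (d' (fst p), e' (snd p)))))) = p"
      by (simp add: d' e')
  qed
  ultimately show "\<exists>d :: nat \<Rightarrow> 'a \<times> 'b. recursive (\<lambda>n. enc (d n)) \<and> surj d"
    unfolding computable_nat_iff by (intro exI[of _ ?f] conjI)
qed

instance list :: (enumerable) enumerable
proof
  obtain d :: "nat \<Rightarrow> 'a" where d: "computable d" "surj d" using ex_decoder by auto
  obtain d' where d': "\<And>x. d (d' x) = x" using surj_f_inv_f[OF d(2)] by blast
  have ld: "computable list_decode"
    by (rule computableI[OF recursive_id]) (simp add: enc_list_def enc_nat_def[abs_def] list.map_ident)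
  let ?f = "\<lambda>n. map (\<lambda>y. d y) (list_decode n)"
  have "computable ?f"
    by (intro computable_map computable_comp[OF _ d(1)] computable_snd computable_id ld)
  moreover have "surj ?f"
    by (rule surjI[of _ "\<lambda>xs. list_encode (map d' xs)"])
      (simp add: d' map_idI)
  ultimately show "\<exists>d :: nat \<Rightarrow> 'a list. recursive (\<lambda>n. enc (d n)) \<and> surj d"
    unfolding computable_nat_iff by (intro exI[of _ ?f] conjI)
qed

text \<open>\<open>Mu\<close> runs through \<open>d 0\<close>, \<open>d 1\<close> and so on until
  the check succeeds. The check is total and \<open>d\<close> is surjective, so the search halts if
  a certificate exists. It may find a different certificate from the one assumed, so the output is
  only known to come from some valid one.\<close>

lemma certificate_search:
  fixes C :: "'a::encodable \<times> 'b::encodable \<times> 'c::encodable \<Rightarrow> 'w::enumerable \<Rightarrow> bool"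
    and out :: "'w \<Rightarrow> 'o::encodable"
  assumes C: "computable (\<lambda>p. C (fst p) (snd p))" and out: "computable out"
  shows "\<exists>alg. \<forall>a b c. (\<exists>w. C (a, b, c) w) \<longrightarrow>
    (\<exists>w. C (a, b, c) w \<and> rec_eval alg [enc a, enc b, enc c] = Some (enc (out w)))"
proof -
  obtain d :: "nat \<Rightarrow> 'w" where d: "computable d" "surj d" using ex_decoder by auto
  \<comment> \<open>Success is coded by \<open>0\<close>, the value that \<open>Mu\<close> looks
    for.\<close>
  have "computable (\<lambda>p. if C (fst p) (d (snd p)) then 0 else 1 :: nat)"
    by (intro computable_intros computable_comp[OF _ C, of "\<lambda>p. (fst p, d (snd p))", simplified]
      computable_comp[OF _ d(1)])
  then obtain g where g: "recursive g"
      "\<And>p. g (enc p) = enc (if C (fst p) (d (snd p)) then 0 else 1 :: nat)"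
    by (rule computableE) auto
  then obtain check where "\<And>x. rec_eval check [x] = Some (g x)" by (auto simp: recursive_def)
  then have check: "rec_eval check [prod_encode (enc i, n)] = Some (if C i (d n) then 0 else 1)"
    for i n using g(2)[of "(i, n)"] by simp
  have "computable (\<lambda>n. out (d n))"
    by (intro computable_comp[OF _ out] d)
  then obtain ro where ro: "\<And>n. rec_eval ro [n] = Some (enc (out (d n)))"
    by (elim computableE) (auto simp: recursive_def)
  \<comment> \<open>\<open>Mu\<close> puts the search variable before the three inputs, which are
    packed here into the code of one triple.\<close>
  define s where "s = Mu (Comp check [Comp r_pair
    [Comp r_pair [Proj 1, Comp r_pair [Proj 2, Proj 3]], Proj 0]])"
  have "\<exists>w. C (a, b, c) w \<and> rec_eval (Comp ro [s]) [enc a, enc b, enc c] = Some (enc (out w))"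
    if "C (a, b, c) w" for a b c w
  proof -
    define g :: "nat \<Rightarrow> nat" where "g n = (if C (a, b, c) (d n) then 0 else 1)" for n
    obtain n0 where "d n0 = w" using d(2) by (metis surjD)
    with that have g0: "g n0 = 0" by (simp add: g_def)
    have "rec_eval s [enc a, enc b, enc c] = Some (LEAST n. g n = 0)"
      unfolding s_def
      by (rule eval_Mu[where g = g and m = n0]) (use check[of "(a, b, c)"] g0 in \<open>simp_all add: g_def\<close>)
    moreover have "C (a, b, c) (d (LEAST n. g n = 0))"
      using LeastI[of "\<lambda>n. g n = 0", OF g0] by (simp add: g_def split: if_splits)
    ultimately show ?thesis by (auto simp: ro)
  qed
  then show ?thesis by blast
qed

section \<open>Words and homomorphisms\<close>

definition word_eval :: "('g, 'm) monoid_scheme \<Rightarrow> ('a \<Rightarrow> 'g) \<Rightarrow> 'a word \<Rightarrow> 'g" where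
  "word_eval G h w = foldr (\<lambda>(x, b) g. (if b then h x else inv\<^bsub>G\<^esub> h x) \<otimes>\<^bsub>G\<^esub> g) w \<one>\<^bsub>G\<^esub>"

text \<open>The counterpart of \<open>subst_words\<close> for an assignment given as a function.
  Combined with \<open>nth_default\<close> it avoids the unspecified entries of a list outside its
  range.\<close>

definition word_subst :: "('a \<Rightarrow> 'b word) \<Rightarrow> 'a word \<Rightarrow> 'b word" where
  "word_subst f w = concat (map (\<lambda>(x, b). if b then f x else word_inv (f x)) w)"

lemma word_eval_Nil [simp]: "word_eval G h [] = \<one>\<^bsub>G\<^esub>"
  by (simp add: word_eval_def)

lemma word_eval_Cons [simp]:
  "word_eval G h ((x, b) # w) = (if b then h x else inv\<^bsub>G\<^esub> h x) \<otimes>\<^bsub>G\<^esub> word_eval G h w"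
  by (simp add: word_eval_def)

lemma words_Cons [simp]: "(x, b) # w \<in> words X \<longleftrightarrow> x \<in> X \<and> w \<in> words X"
  by (auto simp: words_def)

lemma word_subst_Nil [simp]: "word_subst f [] = []"
  by (simp add: word_subst_def)

lemma word_subst_Cons [simp]:
  "word_subst f ((x, b) # w) = (if b then f x else word_inv (f x)) @ word_subst f w"
  by (simp add: word_subst_def)

lemma words_induct [consumes 1, case_names Nil Cons]:
  assumes "w \<in> words X" and "P []"
    and "\<And>x b w. x \<in> X \<Longrightarrow> w \<in> words X \<Longrightarrow> P w \<Longrightarrow> P ((x, b) # w)"
  shows "P w"
  using assms(1) by (induction w) (auto intro: assms)

lemma word_subst_append [simp]: "word_subst f (v @ w) = word_subst f v @ word_subst f w"
  by (simp add: word_subst_def)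

lemma word_subst_in_words:
  assumes "w \<in> words X" and "\<And>x. x \<in> X \<Longrightarrow> f x \<in> words Y"
  shows "word_subst f w \<in> words Y"
  using assms(1) by (induction rule: words_induct) (auto simp: assms(2) word_inv_in_words)

lemma word_inv_Cons: "word_inv ((x, b) # w) = word_inv w @ [(x, \<not> b)]"
  by (simp add: word_inv_def)

context group
begin

lemma word_eval_closed [simp]:
  assumes "w \<in> words X" "h \<in> X \<rightarrow> carrier G"
  shows "word_eval G h w \<in> carrier G"
  using assms(1) by (induction rule: words_induct) (use assms(2) in auto)

lemma word_eval_append:
  assumes "v \<in> words X" "w \<in> words X" "h \<in> X \<rightarrow> carrier G"
  shows "word_eval G h (v @ w) = word_eval G h v \<otimes> word_eval G h w"
  using assms(1)
proof (induction rule: words_induct)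
  case Nil
  show ?case using word_eval_closed[OF assms(2,3)] by simp
next
  case (Cons x b v)
  then have "h x \<in> carrier G" using assms(3) by auto
  then show ?case
    using Cons word_eval_closed[OF assms(2,3)] word_eval_closed[OF Cons(2) assms(3)]
    by (simp add: m_assoc)
qed

lemma word_eval_inv:
  assumes "w \<in> words X" "h \<in> X \<rightarrow> carrier G"
  shows "word_eval G h (word_inv w) = inv (word_eval G h w)"
  using assms(1)
proof (induction rule: words_induct)
  case Nil
  show ?case by (simp add: word_inv_def)
next
  case (Cons x b w)
  then have hx: "h x \<in> carrier G" using assms(2) by auto
  have "word_eval G h (word_inv w @ [(x, \<not> b)]) = inv (word_eval G h w) \<otimes> word_eval G h [(x, \<not> b)]"
    using Cons by (subst word_eval_append[OF _ _ assms(2)]) (auto simp: word_inv_in_words)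
  then show ?case
    using hx word_eval_closed[OF Cons(2) assms(2)] by (simp add: word_inv_Cons inv_mult_group)
qed

lemma word_eval_subst:
  assumes "w \<in> words X" "\<And>x. x \<in> X \<Longrightarrow> f x \<in> words Y" "h \<in> Y \<rightarrow> carrier G"
  shows "word_eval G h (word_subst f w) = word_eval G (\<lambda>x. word_eval G h (f x)) w"
  using assms(1)
proof (induction rule: words_induct)
  case (Cons x b w)
  then show ?case
    using assms word_subst_in_words[OF Cons(2) assms(2)]
    by (simp add: word_eval_append[OF _ _ assms(3)] word_eval_inv[OF _ assms(3)] word_inv_in_words)
qed simp

lemma word_eval_cong:
  assumes "w \<in> words X" "\<And>x. x \<in> X \<Longrightarrow> h x = k x"
  shows "word_eval G h w = word_eval G k w"
  using assms(1) by (induction rule: words_induct) (auto simp: assms(2))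

text \<open>Von Dyck's theorem on the level of words: evaluation is multiplicative, so it is enough
  that cancelling pairs and relators evaluate to the identity.\<close>

lemma word_eval_respects:
  assumes "word_eq X R v w" and R: "R \<subseteq> words X" and h: "h \<in> X \<rightarrow> carrier G"
    and rel: "\<And>r. r \<in> R \<Longrightarrow> word_eval G h r = \<one>"
  shows "word_eval G h v = word_eval G h w"
  using assms(1)
proof (induction rule: word_eq.induct)
  case (cancel u v x b)
  then have "h x \<in> carrier G" using h by auto
  then show ?case
    using cancel h word_eval_closed[OF cancel(2) h]
    by (cases b) (simp_all add: word_eval_append[OF _ _ h] m_assoc[symmetric])
next
  case (relator u v r)
  then show ?case using R rel[of r] word_eval_closed[OF relator(2) h]
    by (subst word_eval_append[OF _ _ h], blast, auto simp: word_eval_append[OF _ _ h])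
qed auto

end

lemma (in group_hom) hom_word_eval:
  assumes "w \<in> words X" "k \<in> X \<rightarrow> carrier G"
  shows "h (word_eval G k w) = word_eval H (\<lambda>x. h (k x)) w"
  using assms(1)
proof (induction rule: words_induct)
  case (Cons x b w)
  then show ?case using assms(2) G.word_eval_closed[OF Cons(2) assms(2)] by (auto simp: Pi_iff)
qed simp

section \<open>Homomorphisms between presented groups\<close>

lemma carrier_presented_group: "carrier (presented_group X R) = word_class X R ` words X"
  and one_presented_group: "\<one>\<^bsub>presented_group X R\<^esub> = word_class X R []"
  by (simp_all add: presented_group_def)

lemma word_class_closed: "w \<in> words X \<Longrightarrow> word_class X R w \<in> carrier (presented_group X R)"
  by (simp add: carrier_presented_group)

lemma inv_word_class:
  assumes "R \<subseteq> words X" "w \<in> words X"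
  shows "inv\<^bsub>presented_group X R\<^esub> (word_class X R w) = word_class X R (word_inv w)"
proof -
  interpret group "presented_group X R" by (rule group_presented_group[OF assms(1)])
  have "word_class X R (word_inv w @ w) = word_class X R []"
    using assms(2) word_eq_inv_left[OF assms(2)]
    by (subst word_class_eq_iff) (auto simp: word_inv_in_words)
  then show ?thesis using assms(2) word_inv_in_words[OF assms(2)]
    by (intro inv_equality) (auto simp: mult_word_class[OF assms(1)] one_presented_group word_class_closed)
qed

text \<open>A link between syntax and algebra: congruences of words can be obtained by evaluating in
  the presented group.\<close>

lemma word_eval_word_class:
  assumes R: "R \<subseteq> words X" and w: "w \<in> words X"
  shows "word_eval (presented_group X R) (\<lambda>x. word_class X R [(x, True)]) w = word_class X R w"
  using w
proof (induction rule: words_induct)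
  case Nil
  show ?case by (simp add: one_presented_group)
next
  case (Cons x b w)
  then show ?case
    by (simp add: inv_word_class[OF R] mult_word_class[OF R] word_inv_def)
qed

lemma word_class_eq_one_iff:
  assumes "w \<in> words X"
  shows "word_class X R w = \<one>\<^bsub>presented_group X R\<^esub> \<longleftrightarrow> word_eq X R w []"
  using word_class_eq_iff[of w X "[]" R] assms by (simp add: one_presented_group)

lemma word_eval_word_class_subst:
  assumes R: "R \<subseteq> words X" and "w \<in> words Y" "\<And>y. y \<in> Y \<Longrightarrow> f y \<in> words X"
  shows "word_eval (presented_group X R) (\<lambda>y. word_class X R (f y)) w
    = word_class X R (word_subst f w)"
proof -
  interpret group "presented_group X R" by (rule group_presented_group[OF R])
  have "word_class X R (word_subst f w)
      = word_eval (presented_group X R) (\<lambda>x. word_class X R [(x, True)]) (word_subst f w)"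
    by (rule word_eval_word_class[symmetric, OF R]) (rule word_subst_in_words[OF assms(2,3)])
  also have "\<dots> = word_eval (presented_group X R)
      (\<lambda>y. word_eval (presented_group X R) (\<lambda>x. word_class X R [(x, True)]) (f y)) w"
    by (rule word_eval_subst[OF assms(2,3)]) (auto simp: word_class_closed)
  also have "\<dots> = word_eval (presented_group X R) (\<lambda>y. word_class X R (f y)) w"
    using assms by (intro word_eval_cong[OF assms(2)] word_eval_word_class[OF R])
  finally show ?thesis ..
qed

text \<open>Von Dyck's theorem with the group presented by \<open>Y\<close> and \<open>S\<close> as
  target and \<open>x\<close> sent to the class of \<open>f x\<close>.\<close>

lemma word_eq_subst:
  assumes R: "R \<subseteq> words X" and S: "S \<subseteq> words Y"
    and f: "\<And>x. x \<in> X \<Longrightarrow> f x \<in> words Y"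
    and rel: "\<And>r. r \<in> R \<Longrightarrow> word_eq Y S (word_subst f r) []"
    and vw: "word_eq X R v w"
  shows "word_eq Y S (word_subst f v) (word_subst f w)"
proof -
  interpret group "presented_group Y S" by (rule group_presented_group[OF S])
  have *: "word_eval (presented_group Y S) (\<lambda>x. word_class Y S (f x)) u = word_class Y S (word_subst f u)"
    if "u \<in> words X" for u
    by (rule word_eval_word_class_subst[OF S that f])
  have "v \<in> words X" "w \<in> words X" using word_eq_words[OF vw R] by auto
  moreover have "word_eval (presented_group Y S) (\<lambda>x. word_class Y S (f x)) v
      = word_eval (presented_group Y S) (\<lambda>x. word_class Y S (f x)) w"
  proof (rule word_eval_respects[OF vw R])
    show "(\<lambda>x. word_class Y S (f x)) \<in> X \<rightarrow> carrier (presented_group Y S)"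
      using f by (auto simp: word_class_closed)
    show "word_eval (presented_group Y S) (\<lambda>x. word_class Y S (f x)) r = \<one>\<^bsub>presented_group Y S\<^esub>"
      if "r \<in> R" for r
    proof -
      have r: "r \<in> words X" using that R by blast
      then show ?thesis
        using rel[OF that] word_subst_in_words[OF r f] by (simp add: * word_class_eq_one_iff)
    qed
  qed
  ultimately show ?thesis
    using word_subst_in_words[of v X f Y] word_subst_in_words[of w X f Y] f
    by (simp add: * word_class_eq_iff)
qed

text \<open>Derivations in a certificate establish that words are trivial; this equivalence lets
  them express that a word equals a generator.\<close>

lemma word_eq_append_inv:
  assumes R: "R \<subseteq> words X" and v: "v \<in> words X" and x: "x \<in> X"
  shows "word_eq X R (v @ [(x, False)]) [] \<longleftrightarrow> word_eq X R v [(x, True)]"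
proof -
  let ?G = "presented_group X R"
  interpret group ?G by (rule group_presented_group[OF R])
  have "word_eq X R (v @ [(x, False)]) [] \<longleftrightarrow>
      word_class X R v \<otimes>\<^bsub>?G\<^esub> inv\<^bsub>?G\<^esub> (word_class X R [(x, True)]) = \<one>\<^bsub>?G\<^esub>"
    using v x by (simp add: inv_word_class[OF R] mult_word_class[OF R] word_inv_def word_class_eq_one_iff)
  also have "\<dots> \<longleftrightarrow> word_class X R v = word_class X R [(x, True)]"
    using v x by (metis inv_closed inv_equality inv_inv r_inv word_class_closed words_Cons words_Nil)
  also have "\<dots> \<longleftrightarrow> word_eq X R v [(x, True)]"
    using v x by (simp add: word_class_eq_iff)
  finally show ?thesis .
qed

text \<open>Substituting \<open>f\<close> and then \<open>g\<close> agrees with the identity on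
  generators by \<open>gf\<close>, and evaluation depends only on the values at generators.\<close>

lemma word_subst_inverse:
  assumes R: "R \<subseteq> words X"
    and f: "\<And>x. x \<in> X \<Longrightarrow> f x \<in> words Y" and g: "\<And>y. y \<in> Y \<Longrightarrow> g y \<in> words X"
    and gf: "\<And>x. x \<in> X \<Longrightarrow> word_eq X R (word_subst g (f x)) [(x, True)]" and w: "w \<in> words X"
  shows "word_eq X R (word_subst g (word_subst f w)) w"
proof -
  let ?G = "presented_group X R"
  interpret group ?G by (rule group_presented_group[OF R])
  have fw: "word_subst f w \<in> words Y" by (rule word_subst_in_words[OF w f])
  have "word_class X R (word_subst g (word_subst f w))
      = word_eval ?G (\<lambda>y. word_class X R (g y)) (word_subst f w)"
    by (rule word_eval_word_class_subst[symmetric, OF R fw g])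
  also have "\<dots> = word_eval ?G (\<lambda>x. word_eval ?G (\<lambda>y. word_class X R (g y)) (f x)) w"
    by (rule word_eval_subst[OF w f]) (auto simp: word_class_closed g)
  also have "\<dots> = word_eval ?G (\<lambda>x. word_class X R [(x, True)]) w"
  proof (rule word_eval_cong[OF w])
    fix x assume x: "x \<in> X"
    have "word_eval ?G (\<lambda>y. word_class X R (g y)) (f x) = word_class X R (word_subst g (f x))"
      by (rule word_eval_word_class_subst[OF R f[OF x] g])
    also have "\<dots> = word_class X R [(x, True)]"
      using gf[OF x] x word_subst_in_words[OF f[OF x] g] by (simp add: word_class_eq_iff)
    finally show "word_eval ?G (\<lambda>y. word_class X R (g y)) (f x) = word_class X R [(x, True)]" .
  qed
  also have "\<dots> = word_class X R w" by (rule word_eval_word_class[OF R w])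
  finally show ?thesis using w word_subst_in_words[OF fw g] by (simp add: word_class_eq_iff)
qed

text \<open>The substitutions induce homomorphisms because they kill the relators, and these are
  mutually inverse because they are so on generators.\<close>

lemma presented_group_iso:
  assumes R: "R \<subseteq> words X" and S: "S \<subseteq> words Y"
    and f: "\<And>x. x \<in> X \<Longrightarrow> f x \<in> words Y" and g: "\<And>y. y \<in> Y \<Longrightarrow> g y \<in> words X"
    and fR: "\<And>r. r \<in> R \<Longrightarrow> word_eq Y S (word_subst f r) []"
    and gS: "\<And>s. s \<in> S \<Longrightarrow> word_eq X R (word_subst g s) []"
    and gf: "\<And>x. x \<in> X \<Longrightarrow> word_eq X R (word_subst g (f x)) [(x, True)]"
    and fg: "\<And>y. y \<in> Y \<Longrightarrow> word_eq Y S (word_subst f (g y)) [(y, True)]"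
  shows "presented_group X R \<cong> presented_group Y S"
proof -
  have fw: "word_subst f w \<in> words Y" if "w \<in> words X" for w
    by (rule word_subst_in_words[OF that f])
  have gw: "word_subst g w \<in> words X" if "w \<in> words Y" for w
    by (rule word_subst_in_words[OF that g])
  \<comment> \<open>An arbitrary representative is chosen; \<open>word_eq_subst\<close> makes the
    result independent of it.\<close>
  define \<phi> where "\<phi> A = word_class Y S (word_subst f (SOME w. w \<in> words X \<and> A = word_class X R w))" for A
  have \<phi>: "\<phi> (word_class X R w) = word_class Y S (word_subst f w)" if w: "w \<in> words X" for w
  proof -
    define v where "v = (SOME v. v \<in> words X \<and> word_class X R w = word_class X R v)"
    have "v \<in> words X \<and> word_class X R w = word_class X R v"
      unfolding v_def by (rule someI[of _ w]) (simp add: w)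
    then have v: "v \<in> words X" "word_eq X R w v" using w word_class_eq_iff by blast+
    have "word_eq Y S (word_subst f w) (word_subst f v)"
      by (rule word_eq_subst[OF R S f fR v(2)])
    then show ?thesis using fw v(1) w by (simp add: \<phi>_def v_def[symmetric] word_class_eq_iff word_eq.sym)
  qed
  have "\<phi> \<in> hom (presented_group X R) (presented_group Y S)"
    by (rule homI) (auto simp: carrier_presented_group \<phi> mult_word_class[OF R]
      mult_word_class[OF S] fw)
  moreover have "bij_betw \<phi> (carrier (presented_group X R)) (carrier (presented_group Y S))"
  proof (rule bij_betwI')
    fix A B assume "A \<in> carrier (presented_group X R)" "B \<in> carrier (presented_group X R)"
    then obtain v w where v: "v \<in> words X" "A = word_class X R v" and w: "w \<in> words X" "B = word_class X R w"
      by (auto simp: carrier_presented_group)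
    \<comment> \<open>Injectivity: substituting \<open>g\<close> on both sides brings back
      \<open>v\<close> and \<open>w\<close>.\<close>
    have "word_eq X R v w" if "word_eq Y S (word_subst f v) (word_subst f w)"
      using word_eq_subst[OF S R g gS that] word_subst_inverse[OF R f g gf v(1)] word_subst_inverse[OF R f g gf w(1)]
      by (meson word_eq.sym word_eq.trans)
    then show "\<phi> A = \<phi> B \<longleftrightarrow> A = B"
      using v w fw word_eq_subst[OF R S f fR, of v w] by (auto simp: \<phi> word_class_eq_iff)
  next
    fix A assume "A \<in> carrier (presented_group X R)"
    then show "\<phi> A \<in> carrier (presented_group Y S)"
      by (auto simp: carrier_presented_group \<phi> fw)
  next
    fix B assume "B \<in> carrier (presented_group Y S)"
    then obtain w where w: "w \<in> words Y" "B = word_class Y S w" by (auto simp: carrier_presented_group)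
    then have "B = \<phi> (word_class X R (word_subst g w))"
      using word_subst_inverse[OF S g f fg w(1)] by (simp add: \<phi> gw fw word_class_eq_iff word_eq.sym)
    then show "\<exists>A\<in>carrier (presented_group X R). B = \<phi> A"
      using gw[OF w(1)] by (auto simp: carrier_presented_group)
  qed
  ultimately show ?thesis by (auto simp: is_iso_def iso_def)
qed

section \<open>Certificates\<close>

text \<open>The letter is sought in \<open>set r\<close>, which makes the quantifier bounded and the
  condition computable.\<close>

definition elementary :: "fin_pres \<Rightarrow> nat word \<Rightarrow> bool" where
  "elementary P r \<longleftrightarrow> r \<in> set (snd P) \<or> (\<exists>p\<in>set r. fst p < fst P \<and> r = [p, (fst p, \<not> snd p)])"

text \<open>A step replaces \<open>p\<close> by \<open>q\<close> in context. One of the two is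
  empty, so elementary words can be inserted as well as deleted. An invalid step changes nothing;
  thus every list of steps is a sound derivation.\<close>

definition rewrite :: "fin_pres \<Rightarrow> nat word \<Rightarrow> nat word \<times> nat word \<times> nat word \<times> nat word \<Rightarrow> nat word" where
  "rewrite P w = (\<lambda>(u, p, q, v).
     if w = u @ p @ v \<and> (p = [] \<and> elementary P q \<or> q = [] \<and> elementary P p) then u @ q @ v else w)"

lemma elementary_word_eq:
  assumes "is_fin_pres P" "elementary P r" "u \<in> words (gens P)" "v \<in> words (gens P)"
  shows "word_eq (gens P) (relators P) (u @ r @ v) (u @ v)"
  using assms(2) unfolding elementary_def
proof
  assume "r \<in> set (snd P)"
  then show ?thesis using assms by (intro word_eq.relator) (auto simp: relators_def)
next
  assume "\<exists>p\<in>set r. fst p < fst P \<and> r = [p, (fst p, \<not> snd p)]"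
  then obtain x b where "x \<in> gens P" "r = [(x, b), (x, \<not> b)]" by (auto simp: gens_def)
  then show ?thesis using word_eq.cancel[OF assms(3,4)] by simp
qed

lemma rewrite_word_eq:
  assumes P: "is_fin_pres P" and w: "w \<in> words (gens P)"
  shows "word_eq (gens P) (relators P) w (rewrite P w e)"
proof -
  obtain u p q v where e: "e = (u, p, q, v)" by (cases e) auto
  consider "rewrite P w e = w"
    | "w = u @ v" "rewrite P w e = u @ q @ v" "elementary P q"
    | "w = u @ p @ v" "rewrite P w e = u @ v" "elementary P p"
    by (cases "w = u @ p @ v \<and> (p = [] \<and> elementary P q \<or> q = [] \<and> elementary P p)")
      (auto simp: rewrite_def e)
  then show ?thesis
  proof cases
    case 1
    then show ?thesis using w by (simp add: word_eq.refl)
  next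
    case 2
    then show ?thesis using elementary_word_eq[OF P, of q u v] w by (simp add: word_eq.sym)
  next
    case 3
    then show ?thesis using elementary_word_eq[OF P, of p u v] w by simp
  qed
qed

lemma foldl_rewrite_word_eq:
  assumes P: "is_fin_pres P" and w: "w \<in> words (gens P)"
  shows "word_eq (gens P) (relators P) w (foldl (rewrite P) w d)"
  using w
proof (induction d arbitrary: w)
  case Nil
  then show ?case by (simp add: word_eq.refl)
next
  case (Cons e d)
  have "word_eq (gens P) (relators P) w (rewrite P w e)"
    by (rule rewrite_word_eq[OF P Cons.prems])
  moreover from this have "rewrite P w e \<in> words (gens P)"
    using word_eq_words P by (fastforce simp: is_fin_pres_def)
  ultimately show ?case using Cons.IH by (auto intro: word_eq.trans)
qed

text \<open>Both directions go through the induction together, as the symmetry rule exchanges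
  them.\<close>

lemma word_eq_foldl_rewrite:
  assumes "word_eq (gens P) (relators P) v w"
  shows "(\<exists>d. foldl (rewrite P) v d = w) \<and> (\<exists>d. foldl (rewrite P) w d = v)"
proof -
  have single: "(\<exists>d. foldl (rewrite P) (u @ r @ v) d = u @ v) \<and>
      (\<exists>d. foldl (rewrite P) (u @ v) d = u @ r @ v)" if "elementary P r" for u r v
    using that
    by (intro conjI exI[of _ "[(u, r, [], v)]"] exI[of _ "[(u, [], r, v)]"]) (auto simp: rewrite_def)
  show ?thesis using assms
  proof (induction rule: word_eq.induct)
    case (refl w)
    show ?case by (auto intro: exI[of _ "[]"])
  next
    case (trans u v w)
    then obtain d d' e e' where "foldl (rewrite P) u d = v" "foldl (rewrite P) v d' = w"
      "foldl (rewrite P) v e = u" "foldl (rewrite P) w e' = v" by blast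
    then show ?case by (auto intro: exI[of _ "d @ d'"] exI[of _ "e' @ e"])
  next
    case (cancel u v x b)
    then have "elementary P [(x, b), (x, \<not> b)]" by (simp add: elementary_def gens_def)
    from single[OF this] show ?case .
  next
    case (relator u v r)
    then have "elementary P r" by (simp add: elementary_def relators_def)
    from single[OF this] show ?case .
  qed blast
qed

lemma ex_foldl_rewrite_iff:
  assumes "is_fin_pres P"
  shows "(\<exists>d. foldl (rewrite P) [] d = w) \<longleftrightarrow> word_eq (gens P) (relators P) w []"
  using foldl_rewrite_word_eq[OF assms, of "[]"] word_eq_foldl_rewrite[of P w "[]"]
  by (auto intro: word_eq.sym)

text \<open>\<open>D\<close> is a common pool, any member of which may derive \<open>w\<close>.
  Since steps invalid for \<open>P\<close> do nothing, derivations meant for other presentations can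
  share it.\<close>

definition derivable :: "fin_pres \<Rightarrow> (nat word \<times> nat word \<times> nat word \<times> nat word) list list \<Rightarrow> nat word \<Rightarrow> bool"
  where "derivable P D w \<longleftrightarrow> (\<exists>d\<in>set D. foldl (rewrite P) [] d = w)"

lemma derivable_word_eq: "is_fin_pres P \<Longrightarrow> derivable P D w \<Longrightarrow> word_eq (gens P) (relators P) w []"
  using ex_foldl_rewrite_iff[of P w] by (auto simp: derivable_def)

lemma derivable_mono: "derivable P D w \<Longrightarrow> set D \<subseteq> set E \<Longrightarrow> derivable P E w"
  by (auto simp: derivable_def)

lemma ex_derivable:
  assumes P: "is_fin_pres P" and "finite W" "\<And>w. w \<in> W \<Longrightarrow> word_eq (gens P) (relators P) w []"
  shows "\<exists>D. \<forall>w\<in>W. derivable P D w"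
proof -
  have "\<forall>w\<in>W. \<exists>d. foldl (rewrite P) [] d = w" using assms(3) ex_foldl_rewrite_iff[OF P] by blast
  then obtain d where d: "\<forall>w\<in>W. foldl (rewrite P) [] (d w) = w" by metis
  obtain ws where "set ws = W" using finite_list[OF assms(2)] by blast
  then have "\<forall>w\<in>W. derivable P (map d ws) w" using d by (auto simp: derivable_def)
  then show ?thesis by blast
qed

section \<open>Certificates and their decidability\<close>

abbreviation nth_word :: "nat word list \<Rightarrow> nat \<Rightarrow> nat word" where
  "nth_word \<equiv> nth_default []"

type_synonym cert = "nat word list \<times> nat word list \<times> nat word list
  \<times> (nat word \<times> nat word \<times> nat word \<times> nat word) list list"

text \<open>The isomorphism certified is that of the new presentation with \<open>Q\<close>; in
  \<open>P\<close> only the triviality of the words in \<open>cs\<close> is certified, and the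
  subgroup enters through the isomorphism given in advance. An equation with a generator is recorded
  as triviality of a word followed by the inverse letter, and indices run over lists to keep
  quantifiers bounded.\<close>

definition certifies :: "fin_pres \<times> nat word list \<times> fin_pres \<Rightarrow> cert \<Rightarrow> bool" where
  "certifies = (\<lambda>(P, ws, Q) (cs, fs, gs, D).
     (\<forall>c\<in>set cs. c \<in> words {..<length ws}
        \<and> derivable P D (word_subst (nth_word ws) c) \<and> derivable Q D (word_subst (nth_word gs) c)) \<and>
     (\<forall>f\<in>set fs. f \<in> words {..<length ws}) \<and>
     (\<forall>g\<in>set gs. g \<in> words {..<fst Q}) \<and>
     (\<forall>s\<in>set (snd Q). derivable (length ws, cs) D (word_subst (nth_word fs) s)) \<and>
     (\<forall>y\<in>set [0..<fst Q].
        derivable Q D (word_subst (nth_word gs) (nth_word fs y) @ [(y, False)])) \<and>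
     (\<forall>i\<in>set [0..<length ws].
        derivable (length ws, cs) D (word_subst (nth_word fs) (nth_word gs i) @ [(i, False)])))"

lemma computable_words [computable_intros]:
  fixes w :: "'a::encodable \<Rightarrow> nat word"
  assumes "computable w" "computable m"
  shows "computable (\<lambda>x. w x \<in> words {..<m x})"
proof -
  have *: "w \<in> words {..<m} \<longleftrightarrow> (\<forall>p\<in>set w. fst p < m)" for w :: "nat word" and m
    by (auto simp: words_def)
  show ?thesis unfolding * by (intro computable_intros assms computable_comp[OF _ assms(2)])
qed

lemma computable_word_inv [computable_intros]:
  fixes w :: "'a::encodable \<Rightarrow> nat word"
  assumes "computable w" shows "computable (\<lambda>x. word_inv (w x))"
  unfolding word_inv_def split_def by (intro computable_intros assms)

lemma computable_word_subst [computable_intros]: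
  assumes "computable fs" "computable w"
  shows "computable (\<lambda>x. word_subst (nth_word (fs x)) (w x))"
  unfolding word_subst_def split_def
  by (intro computable_intros assms computable_comp[OF _ assms(1)])

lemma computable_elementary [computable_intros]:
  assumes "computable P" "computable r"
  shows "computable (\<lambda>x. elementary (P x) (r x))"
  unfolding elementary_def
  by (intro computable_intros assms computable_comp[OF _ assms(1)] computable_comp[OF _ assms(2)])

lemma computable_rewrite [computable_intros]:
  assumes "computable P" "computable w" "computable e"
  shows "computable (\<lambda>x. rewrite (P x) (w x) (e x))"
  unfolding rewrite_def split_def by (intro computable_intros assms)

lemma computable_derivable [computable_intros]:
  assumes "computable P" "computable D" "computable w"
  shows "computable (\<lambda>x. derivable (P x) (D x) (w x))"
  unfolding derivable_def
  by (intro computable_intros computable_foldl assms computable_comp[OF _ assms(1)]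
    computable_comp[OF _ assms(3)])

lemma computable_certifies: "computable (\<lambda>p. certifies (fst p) (snd p))"
  unfolding certifies_def split_def by (intro computable_intros)

section \<open>Soundness of certificates\<close>

text \<open>Derivations yield congruences of words. Those in \<open>P\<close> give the triviality of
  \<open>cs\<close>; the others are the hypotheses of \<open>presented_group_iso\<close> for
  substitution by \<open>gs\<close> and \<open>fs\<close>.\<close>

lemma certifies_sound:
  assumes P: "is_fin_pres P" and ws: "set ws \<subseteq> words (gens P)" and Q: "is_fin_pres Q"
    and cert: "certifies (P, ws, Q) (cs, fs, gs, D)"
  shows "set cs \<subseteq> words {..<length ws}"
    and "\<forall>c\<in>set cs. elem_of P (subst_words ws c) = \<one>\<^bsub>group_of P\<^esub>"
    and "group_of (length ws, cs) \<cong> group_of Q"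
proof -
  let ?N = "(length ws, cs)"
  note cert' = cert[unfolded certifies_def prod.case]
  show cs: "set cs \<subseteq> words {..<length ws}" using cert' by blast
  then have N: "is_fin_pres ?N" by (simp add: is_fin_pres_def gens_def relators_def)
  have subst: "subst_words ws c = word_subst (nth_word ws) c" if "c \<in> words {..<length ws}" for c
    using that by (induction rule: words_induct) (auto simp: subst_words_def nth_default_def)
  \<comment> \<open>The default \<open>[]\<close> is a word over any alphabet, so this holds for
    indices out of range too.\<close>
  have w: "nth_word ws i \<in> words (gens P)" for i
    using ws by (auto simp: nth_default_def)
  show "\<forall>c\<in>set cs. elem_of P (subst_words ws c) = \<one>\<^bsub>group_of P\<^esub>"
  proof
    fix c assume c: "c \<in> set cs"
    then have trivial: "word_eq (gens P) (relators P) (word_subst (nth_word ws) c) []"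
      using cert' derivable_word_eq[OF P] by blast
    have "c \<in> words {..<length ws}" using c cs by blast
    then show "elem_of P (subst_words ws c) = \<one>\<^bsub>group_of P\<^esub>"
      using trivial word_subst_in_words[of c "{..<length ws}" "nth_word ws" "gens P"] w
      by (simp add: elem_of_def group_of_def word_class_eq_one_iff subst)
  qed
  have f: "nth_word fs y \<in> words (gens ?N)" for y
    using cert' by (auto simp: nth_default_def gens_def)
  have g: "nth_word gs i \<in> words (gens Q)" for i
    using cert' by (auto simp: nth_default_def gens_def)
  show "group_of ?N \<cong> group_of Q"
    unfolding group_of_def
  proof (rule presented_group_iso[where f = "nth_word gs" and g = "nth_word fs"])
    show R: "relators ?N \<subseteq> words (gens ?N)" "relators Q \<subseteq> words (gens Q)"
      using N Q by (auto simp: is_fin_pres_def)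
    show "word_eq (gens Q) (relators Q) (word_subst (nth_word gs) r) []" if "r \<in> relators ?N" for r
    proof (rule derivable_word_eq[OF Q])
      show "derivable Q D (word_subst (nth_word gs) r)" using that cert' by (auto simp: relators_def)
    qed
    show "word_eq (gens ?N) (relators ?N) (word_subst (nth_word fs) s) []" if "s \<in> relators Q" for s
    proof (rule derivable_word_eq[OF N])
      show "derivable ?N D (word_subst (nth_word fs) s)" using that cert' by (auto simp: relators_def)
    qed
    show "word_eq (gens ?N) (relators ?N) (word_subst (nth_word fs) (nth_word gs i)) [(i, True)]"
      if "i \<in> gens ?N" for i
      using that cert' word_subst_in_words[OF g f]
      by (intro word_eq_append_inv[THEN iffD1, OF R(1)] derivable_word_eq[OF N]) (auto simp: gens_def)
    show "word_eq (gens Q) (relators Q) (word_subst (nth_word gs) (nth_word fs y)) [(y, True)]"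
      if "y \<in> gens Q" for y
      using that cert' word_subst_in_words[OF f g]
      by (intro word_eq_append_inv[THEN iffD1, OF R(2)] derivable_word_eq[OF Q]) (auto simp: gens_def)
  qed (use f g in auto)
qed

section \<open>Existence of certificates\<close>

text \<open>Values of words include the generators and their inverses and are closed under products.
  This provides the words for the images of the generators of \<open>Q\<close>.\<close>

lemma (in group) generate_word_eval:
  assumes "a \<in> generate G (h ` X)" "h \<in> X \<rightarrow> carrier G"
  shows "\<exists>c\<in>words X. a = word_eval G h c"
  using assms(1)
proof (induction rule: generate.induct)
  case one
  show ?case by (rule bexI[of _ "[]"]) auto
next
  case (incl a)
  then obtain x where "x \<in> X" "a = h x" by auto
  then show ?case using assms(2) by (intro bexI[of _ "[(x, True)]"]) (auto simp: Pi_iff)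
next
  case (inv a)
  then obtain x where "x \<in> X" "a = h x" by auto
  then show ?case using assms(2) by (intro bexI[of _ "[(x, False)]"]) (auto simp: Pi_iff)
next
  case (eng a b)
  then obtain v w where "v \<in> words X" "w \<in> words X" "a = word_eval G h v" "b = word_eval G h w"
    by auto
  then show ?case by (intro bexI[of _ "v @ w"]) (auto simp: word_eval_append[OF _ _ assms(2)])
qed

text \<open>Since every trivial word has a derivation, only the truth of the required equations
  matters. They are verified by evaluating in \<open>P\<close>, and injectivity of
  \<open>\<theta>\<close> carries them over to \<open>Q\<close>.\<close>

lemma ex_certificate:
  assumes P: "is_fin_pres P" and ws: "set ws \<subseteq> words (gens P)" and Q: "is_fin_pres Q"
    and iso: "group_of Q \<cong> word_subgroup P ws"
  shows "\<exists>c. certifies (P, ws, Q) c"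
proof -
  let ?n = "length ws" and ?\<omega> = "nth_word ws"
  define h where "h i = elem_of P (?\<omega> i)" for i
  have RP: "relators P \<subseteq> words (gens P)" and RQ: "relators Q \<subseteq> words (gens Q)"
    using P Q by (auto simp: is_fin_pres_def)
  interpret P: group "group_of P" unfolding group_of_def by (rule group_presented_group[OF RP])
  interpret Q: group "group_of Q" unfolding group_of_def by (rule group_presented_group[OF RQ])
  have \<omega>: "?\<omega> i \<in> words (gens P)" for i using ws by (auto simp: nth_default_def)
  have h: "h \<in> {..<?n} \<rightarrow> carrier (group_of P)"
    using \<omega> by (auto simp: h_def elem_of_def group_of_def word_class_closed)
  have img: "h ` {..<?n} = elem_of P ` set ws"
    by (auto simp: h_def nth_default_def set_conv_nth)
  then have sub: "elem_of P ` set ws \<subseteq> carrier (group_of P)" using h by (metis image_subset_iff_funcset)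
  have Qc: "elem_of Q w \<in> carrier (group_of Q)" if "w \<in> words (gens Q)" for w
    using that by (simp add: elem_of_def group_of_def word_class_closed)
  have carrier_sub: "carrier (word_subgroup P ws) = generate (group_of P) (h ` {..<?n})"
    using sub by (simp add: word_subgroup_def carrier_subgroup_generated img Int_absorb1)
  have sub_P: "carrier (word_subgroup P ws) \<subseteq> carrier (group_of P)"
    unfolding word_subgroup_def by (rule P.carrier_subgroup_generated_subset)
  obtain \<theta> where "\<theta> \<in> Group.iso (group_of Q) (word_subgroup P ws)"
    using iso by (auto simp: is_iso_def)
  then have \<theta>_hom: "\<theta> \<in> hom (group_of Q) (word_subgroup P ws)"
    and bij: "bij_betw \<theta> (carrier (group_of Q)) (carrier (word_subgroup P ws))"
    by (auto simp: iso_def)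
  \<comment> \<open>With the codomain enlarged to the whole group, all evaluations take place in
    \<open>group_of P\<close>.\<close>
  then have "\<theta> \<in> hom (group_of Q) (group_of P)"
    using sub_P by (auto simp: hom_def word_subgroup_def)
  then interpret \<theta>: group_hom "group_of Q" "group_of P" \<theta> by unfold_locales
  have inj: "\<theta> a = \<theta> b \<longleftrightarrow> a = b" if "a \<in> carrier (group_of Q)" "b \<in> carrier (group_of Q)" for a b
    using bij that by (auto simp: bij_betw_def inj_on_def)
  have "\<exists>c\<in>words {..<?n}. \<theta> (elem_of Q [(y, True)]) = word_eval (group_of P) h c" if "y \<in> gens Q" for y
  proof (rule P.generate_word_eval[OF _ h])
    show "\<theta> (elem_of Q [(y, True)]) \<in> generate (group_of P) (h ` {..<?n})"
      using bij that Qc[of "[(y, True)]"] by (auto simp: bij_betw_def carrier_sub[symmetric])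
  qed
  then obtain f where f: "\<And>y. y \<in> gens Q \<Longrightarrow> f y \<in> words {..<?n}"
      "\<And>y. y \<in> gens Q \<Longrightarrow> \<theta> (elem_of Q [(y, True)]) = word_eval (group_of P) h (f y)"
    by metis
  have "\<exists>w\<in>words (gens Q). \<theta> (elem_of Q w) = h i" if "i < ?n" for i
  proof -
    have "h i \<in> carrier (word_subgroup P ws)"
      using that by (auto simp: carrier_sub intro: generate.incl)
    then obtain a where "a \<in> carrier (group_of Q)" "\<theta> a = h i"
      unfolding bij_betw_imp_surj_on[OF bij, symmetric] by (metis imageE)
    then show ?thesis by (auto simp: group_of_def elem_of_def carrier_presented_group)
  qed
  then obtain g where g: "\<And>i. i < ?n \<Longrightarrow> g i \<in> words (gens Q)"
      "\<And>i. i < ?n \<Longrightarrow> \<theta> (elem_of Q (g i)) = h i"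
    by metis
  define fs where "fs = map f [0..<fst Q]"
  define gs where "gs = map g [0..<?n]"
  have fs: "nth_word fs y = f y" if "y \<in> gens Q" for y
    using that by (simp add: fs_def nth_default_def gens_def)
  have gs: "nth_word gs i = g i" if "i < ?n" for i
    using that by (simp add: gs_def nth_default_def)
  have fsw: "nth_word fs y \<in> words {..<?n}" if "y \<in> gens Q" for y using f fs that by simp
  have gsw: "nth_word gs i \<in> words (gens Q)" if "i \<in> {..<?n}" for i using g gs that by simp
  \<comment> \<open>Substitution by \<open>fs\<close> realises \<open>\<theta>\<close> on
    words.\<close>
  have eval_f: "word_eval (group_of P) h (word_subst (nth_word fs) s) = \<theta> (elem_of Q s)"
    if s: "s \<in> words (gens Q)" for s
  proof -
    have "\<theta> (elem_of Q s) = \<theta> (word_eval (group_of Q) (\<lambda>y. elem_of Q [(y, True)]) s)"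
      using word_eval_word_class[OF RQ s] by (simp add: elem_of_def group_of_def)
    also have "\<dots> = word_eval (group_of P) (\<lambda>y. \<theta> (elem_of Q [(y, True)])) s"
      by (rule \<theta>.hom_word_eval[OF s]) (auto simp: Qc)
    also have "\<dots> = word_eval (group_of P) (\<lambda>y. word_eval (group_of P) h (nth_word fs y)) s"
      using f fs by (intro P.word_eval_cong[OF s]) simp
    also have "\<dots> = word_eval (group_of P) h (word_subst (nth_word fs) s)"
      by (rule P.word_eval_subst[symmetric, OF s fsw h])
    finally show ?thesis ..
  qed
  \<comment> \<open>Substitution by \<open>gs\<close> realises the inverse of
    \<open>\<theta>\<close>, so that words in the formal generators trivial in \<open>P\<close>
    become trivial in \<open>Q\<close>.\<close>
  have eval_g: "\<theta> (elem_of Q (word_subst (nth_word gs) c)) = word_eval (group_of P) h c"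
    if c: "c \<in> words {..<?n}" for c
  proof -
    have "\<theta> (elem_of Q (word_subst (nth_word gs) c))
        = \<theta> (word_eval (group_of Q) (\<lambda>i. elem_of Q (nth_word gs i)) c)"
      using word_eval_word_class_subst[OF RQ c gsw] by (simp add: elem_of_def group_of_def)
    also have "\<dots> = word_eval (group_of P) (\<lambda>i. \<theta> (elem_of Q (nth_word gs i))) c"
      by (rule \<theta>.hom_word_eval[OF c]) (auto simp: Qc gsw)
    also have "\<dots> = word_eval (group_of P) h c"
      using g gs by (intro P.word_eval_cong[OF c]) simp
    finally show ?thesis .
  qed
  have trivial_P: "word_eq (gens P) (relators P) (word_subst ?\<omega> c) []"
    if "c \<in> words {..<?n}" "word_eval (group_of P) h c = \<one>\<^bsub>group_of P\<^esub>" for c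
    using that word_eval_word_class_subst[OF RP that(1) \<omega>]
      word_class_eq_one_iff[OF word_subst_in_words[OF that(1) \<omega>]]
    by (simp add: h_def[abs_def] elem_of_def group_of_def)
  have trivial_Q: "word_eq (gens Q) (relators Q) (word_subst (nth_word gs) c) []"
    if c: "c \<in> words {..<?n}" "word_eval (group_of P) h c = \<one>\<^bsub>group_of P\<^esub>" for c
  proof -
    have gc: "word_subst (nth_word gs) c \<in> words (gens Q)" by (rule word_subst_in_words[OF c(1) gsw])
    have "\<theta> (elem_of Q (word_subst (nth_word gs) c)) = \<theta> \<one>\<^bsub>group_of Q\<^esub>"
      using eval_g[OF c(1)] c(2) by simp
    then have "elem_of Q (word_subst (nth_word gs) c) = \<one>\<^bsub>group_of Q\<^esub>"
      using inj[OF Qc[OF gc] Q.one_closed] by simp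
    then show ?thesis using word_class_eq_one_iff[OF gc] by (simp add: elem_of_def group_of_def)
  qed
  \<comment> \<open>The first block makes substitution by \<open>fs\<close> a homomorphism into the
    new group; the second forces its composite with \<open>gs\<close> to fix each formal
    generator.\<close>
  define cs where "cs = map (word_subst (nth_word fs)) (snd Q)
    @ map (\<lambda>i. word_subst (nth_word fs) (nth_word gs i) @ [(i, False)]) [0..<?n]"
  have cs: "c \<in> words {..<?n} \<and> word_eval (group_of P) h c = \<one>\<^bsub>group_of P\<^esub>" if c: "c \<in> set cs" for c
  proof -
    consider s where "s \<in> relators Q" "c = word_subst (nth_word fs) s"
      | i where "i < ?n" "c = word_subst (nth_word fs) (nth_word gs i) @ [(i, False)]"
      using c by (auto simp: cs_def relators_def)
    then show ?thesis
    proof cases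
      case 1
      then have s: "s \<in> words (gens Q)" using RQ by auto
      have "elem_of Q s = \<one>\<^bsub>group_of Q\<^esub>"
        using word_eq.relator[of "[]" "gens Q" "[]" s "relators Q"] 1 word_class_eq_one_iff[OF s]
        by (simp add: elem_of_def group_of_def)
      then show ?thesis using 1 eval_f[OF s] word_subst_in_words[OF s fsw] by simp
    next
      case 2
      then have i: "i \<in> {..<?n}" by simp
      have w: "word_subst (nth_word fs) (nth_word gs i) \<in> words {..<?n}"
        by (rule word_subst_in_words[OF gsw[OF i] fsw])
      have hi: "h i \<in> carrier (group_of P)" using h i by auto
      have "word_eval (group_of P) h c = word_eval (group_of P) h
          (word_subst (nth_word fs) (nth_word gs i)) \<otimes>\<^bsub>group_of P\<^esub> word_eval (group_of P) h [(i, False)]"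
        unfolding 2(2) by (rule P.word_eval_append[OF w _ h]) (use i in simp)
      also have "\<dots> = \<one>\<^bsub>group_of P\<^esub>" using eval_f[OF gsw[OF i]] g(2) gs 2(1) hi by simp
      finally show ?thesis using 2 w by simp
    qed
  qed
  let ?N = "(?n, cs)"
  have N: "is_fin_pres ?N" using cs by (auto simp: is_fin_pres_def gens_def relators_def)
  have "\<exists>D. \<forall>w\<in>word_subst ?\<omega> ` set cs. derivable P D w"
    using cs trivial_P by (intro ex_derivable[OF P]) auto
  then obtain D1 where D1: "\<And>c. c \<in> set cs \<Longrightarrow> derivable P D1 (word_subst ?\<omega> c)" by blast
  have "\<exists>D. \<forall>w\<in>word_subst (nth_word gs) ` set cs. derivable Q D w"
    using cs trivial_Q by (intro ex_derivable[OF Q]) auto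
  then obtain D2 where D2: "\<And>c. c \<in> set cs \<Longrightarrow> derivable Q D2 (word_subst (nth_word gs) c)" by blast
  \<comment> \<open>Here no freedom is left, as \<open>Q\<close> is given: the word
    \<open>f y\<close> evaluates to the image of \<open>y\<close> under \<open>\<theta>\<close>, and
    injectivity yields the equation.\<close>
  have "word_eq (gens Q) (relators Q) (word_subst (nth_word gs) (nth_word fs y) @ [(y, False)]) []"
    if y: "y \<in> gens Q" for y
  proof -
    have w: "word_subst (nth_word gs) (nth_word fs y) \<in> words (gens Q)"
      by (rule word_subst_in_words[OF fsw[OF y] gsw])
    have "\<theta> (elem_of Q (word_subst (nth_word gs) (nth_word fs y))) = \<theta> (elem_of Q [(y, True)])"
      using eval_g[OF fsw[OF y]] f(2)[OF y] fs[OF y] by simp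
    then have "elem_of Q (word_subst (nth_word gs) (nth_word fs y)) = elem_of Q [(y, True)]"
      using inj[OF Qc[OF w] Qc[of "[(y, True)]"]] y by simp
    then show ?thesis using y w word_class_eq_iff[OF w, of "[(y, True)]"]
      by (simp add: word_eq_append_inv[OF RQ w y] elem_of_def)
  qed
  then have "\<exists>D. \<forall>w\<in>(\<lambda>y. word_subst (nth_word gs) (nth_word fs y) @ [(y, False)]) ` gens Q. derivable Q D w"
    by (intro ex_derivable[OF Q]) (auto simp: gens_def)
  then obtain D3 where D3: "\<And>y. y \<in> gens Q \<Longrightarrow>
      derivable Q D3 (word_subst (nth_word gs) (nth_word fs y) @ [(y, False)])" by blast
  \<comment> \<open>All words to be derived over \<open>?N\<close> are literally entries of
    \<open>cs\<close>, hence relators.\<close>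
  have "word_eq (gens ?N) (relators ?N) c []" if "c \<in> set cs" for c
    using word_eq.relator[of "[]" "gens ?N" "[]" c "relators ?N"] that by (simp add: relators_def)
  then have "\<exists>D. \<forall>c\<in>set cs. derivable ?N D c" by (intro ex_derivable[OF N]) auto
  then obtain D4 where D4: "\<And>c. c \<in> set cs \<Longrightarrow> derivable ?N D4 c" by blast
  define D where "D = D1 @ D2 @ D3 @ D4"
  have D: "set D1 \<subseteq> set D" "set D2 \<subseteq> set D" "set D3 \<subseteq> set D" "set D4 \<subseteq> set D"
    by (auto simp: D_def)
  have "certifies (P, ws, Q) (cs, fs, gs, D)"
    unfolding certifies_def prod.case
  proof (intro conjI ballI)
    fix c assume c: "c \<in> set cs"
    show "c \<in> words {..<?n}" using cs[OF c] by simp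
    show "derivable P D (word_subst ?\<omega> c)" by (rule derivable_mono[OF D1[OF c] D(1)])
    show "derivable Q D (word_subst (nth_word gs) c)" by (rule derivable_mono[OF D2[OF c] D(2)])
  next
    show "w \<in> words {..<?n}" if "w \<in> set fs" for w using that f(1) by (auto simp: fs_def gens_def)
    show "w \<in> words {..<fst Q}" if "w \<in> set gs" for w using that g(1) by (auto simp: gs_def gens_def)
    show "derivable ?N D (word_subst (nth_word fs) s)" if "s \<in> set (snd Q)" for s
      using that by (intro derivable_mono[OF D4 D(4)]) (auto simp: cs_def)
    show "derivable Q D (word_subst (nth_word gs) (nth_word fs y) @ [(y, False)])"
      if "y \<in> set [0..<fst Q]" for y
      using that by (intro derivable_mono[OF D3 D(3)]) (auto simp: gens_def)
    show "derivable ?N D (word_subst (nth_word fs) (nth_word gs i) @ [(i, False)])"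
      if "i \<in> set [0..<?n]" for i
      using that by (intro derivable_mono[OF D4 D(4)]) (auto simp: cs_def)
  qed
  then show ?thesis by blast
qed

section \<open>Agreement of the codings, and the algorithm\<close>

lemma enc_word: "enc (w :: nat word) = encode_word w"
  by (simp add: enc_list_def encode_word_def encode_letter_def split_def cong: map_cong)

lemma enc_words: "enc (ws :: nat word list) = encode_words ws"
  by (simp add: enc_list_def[of ws] encode_words_def enc_word cong: map_cong)

lemma enc_pres: "enc (P :: fin_pres) = encode_pres P"
  by (simp add: encode_pres_def enc_words)

theorem proposition3p5:
  shows "\<exists>alg :: recf. \<forall>(P :: fin_pres) (ws :: nat word list) (Q :: fin_pres).
    is_fin_pres P \<and> set ws \<subseteq> words (gens P) \<and>
    finitely_presentable (word_subgroup P ws) \<and>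
    is_fin_pres Q \<and> group_of Q \<cong> word_subgroup P ws
    \<longrightarrow>
    (\<exists>cs :: nat word list.
       rec_eval alg [encode_pres P, encode_words ws, encode_pres Q] = Some (encode_words cs) \<and>
       set cs \<subseteq> words {..<length ws} \<and>
       (\<forall>c\<in>set cs. elem_of P (subst_words ws c) = \<one>\<^bsub>group_of P\<^esub>) \<and>
       group_of (length ws, cs) \<cong> group_of Q \<and>
       group_of (length ws, cs) \<cong> word_subgroup P ws)"
proof -
  have "computable (\<lambda>c :: cert. fst c)" by (intro computable_intros)
  from certificate_search[OF computable_certifies this]
  obtain alg where alg: "\<And>P ws Q. \<exists>c. certifies (P, ws, Q) c \<Longrightarrow>
      \<exists>c. certifies (P, ws, Q) c
        \<and> rec_eval alg [encode_pres P, encode_words ws, encode_pres Q] = Some (encode_words (fst c))"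
    unfolding enc_words enc_pres by blast
  show ?thesis
  proof (intro exI[of _ alg] allI impI, elim conjE)
    fix P Q :: fin_pres and ws :: "nat word list"
    assume P: "is_fin_pres P" and ws: "set ws \<subseteq> words (gens P)" and Q: "is_fin_pres Q"
      and iso: "group_of Q \<cong> word_subgroup P ws"
    obtain cs fs gs D where c: "certifies (P, ws, Q) (cs, fs, gs, D)"
        and "rec_eval alg [encode_pres P, encode_words ws, encode_pres Q] = Some (encode_words cs)"
      using alg[OF ex_certificate[OF P ws Q iso]] by (auto simp del: rec_eval.simps)
    moreover note sound = certifies_sound[OF P ws Q c]
    \<comment> \<open>The isomorphism with the subgroup is the certified one followed by the given
      one.\<close>
    ultimately show "\<exists>cs. rec_eval alg [encode_pres P, encode_words ws, encode_pres Q] = Some (encode_words cs) \<and>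
       set cs \<subseteq> words {..<length ws} \<and>
       (\<forall>c\<in>set cs. elem_of P (subst_words ws c) = \<one>\<^bsub>group_of P\<^esub>) \<and>
       group_of (length ws, cs) \<cong> group_of Q \<and>
       group_of (length ws, cs) \<cong> word_subgroup P ws"
      using iso_trans[OF sound(3) iso] by blast
  qed
qed

end
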